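(* Let $F\colon X\to Y\cup\{+\infty_Y\}$ be proper and $K$-convex, $G\colon X\to Z\cup\{+\infty_Z\}$ proper and $S$-convex, $C\subset X$ nonempty and convex, $A:=C\cap G^{-1}(-S)$, and assume $A\cap\operatorname{dom}F\neq\emptyset$. Consider the conditions $(C_1)$ there is $x_1\in C\cap\operatorname{dom}F$ with $G(x_1)\in-\operatorname{int}S$; $(C_2)$ there is $x_2\in C\cap\operatorname{dom}G$ such that $F$ is continuous at $x_2$; $(C_3)$ there is $x_3\in C$ such that $G$ is continuous at $x_3$. For $(L,y)\in\mathcal{L}(X,Y)\times Y$ consider the statements: $(\alpha)$ for every $x\in X$: $x\in C$ and $G(x)\in-S$ imply $F(x)-L(x)+y\notin-\operatorname{int}K$; $(\beta_1)$ there is $T\in\mathcal{L}_+(S,K)$ with $(F+I_C+T\circ G)^*(L)\subset Y$ and $\big(y-(F+I_C+T\circ G)^*(L)\big)\cap(-\operatorname{int}K)=\emptyset$; $(\beta_2)$ there are $L'\in\mathcal{L}(X,Y)$ and $T\in\mathcal{L}_+(S,K)$ with $F^*(L')\uplus(I_C+T\circ G)^*(L-L')\subset Y$ and $\big(y-F^*(L')-(I_C+T\circ G)^*(L-L')\big)\cap(-\operatorname{int}K)=\emptyset$; $(\beta_3)$ there are $L',L''\in\mathcal{L}(X,Y)$ and $T\in\mathcal{L}_+(S,K)$ with $F^*(L')\uplus I_C^*(L'')\uplus(T\circ G)^*(L-L'-L'')\subset Y$ and $\big(y-F^*(L')-I_C^*(L'')-(T\circ G)^*(L-L'-L'')\big)\cap(-\operatorname{int}K)=\emptyset$.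 Then: (i) If $(C_1)$ holds, then $(\alpha)\Leftrightarrow(\beta_1)$ for all $(L,y)\in\mathcal{L}(X,Y)\times Y$. (ii) If $(C_1)$ and $(C_2)$ hold, then $(\alpha)\Leftrightarrow(\beta_2)$ for all $(L,y)\in\mathcal{L}(X,Y)\times Y$. (iii) If $(C_1)$, $(C_2)$ and $(C_3)$ hold, then $(\alpha)\Leftrightarrow(\beta_3)$ for all $(L,y)\in\mathcal{L}(X,Y)\times Y$.
   Context: **Spaces and order.** $X,Y,Z$ are locally convex Hausdorff topological vector spaces; $K\subset Y$ is a proper ($K\ne Y$) closed convex cone with $\operatorname{int}K\neq\emptyset$; $S\subset Z$ is a nonempty closed convex cone. In $Y$: $y_1<_K y_2$ iff $y_1-y_2\in-\operatorname{int}K$, and $y_1\leqq_K y_2$ iff $y_1-y_2\in-K$. $Y^\bullet:=Y\cup\{-\infty_Y,+\infty_Y\}$ with $-\infty_Y<_K y<_K+\infty_Y$ for all $y\in Y$ (and $-\infty_Y<_K+\infty_Y$). Conventions: $-(\pm\infty_Y)=\mp\infty_Y$; $(+\infty_Y)+y=+\infty_Y$ for $y\in Y\cup\{+\infty_Y\}$; $(-\infty_Y)+y=-\infty_Y$ for $y\in Y\cup\{-\infty_Y\}$; sums and differences of sets are elementwise. **Weak supremum and WS-sum.** For $M\subset Y^\bullet$, $\operatorname{WSup}M$ is the set of $\bar v\in Y^\bullet$ such that $\bar v\not<_K v$ for all $v\in M$ and, for every $\tilde v\in Y^\bullet$ with $\tilde v<_K\bar v$, there is $v\in M$ with $\tilde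 v<_K v$. $\mathcal{P}_p(Y)$ is the collection of all $U\subset Y$ such that $Y=(U-\operatorname{int}K)\cup U\cup(U+\operatorname{int}K)$ with the three sets pairwise disjoint. For $U,V\in\mathcal{P}_p(Y)\cup\{\{+\infty_Y\}\}$, $U\uplus V:=\operatorname{WSup}(U+V)$, which again lies in $\mathcal{P}_p(Y)\cup\{\{+\infty_Y\}\}$; $\uplus$ is associative and commutative. **Mappings.** For $H\colon X\to Y\cup\{+\infty_Y\}$, $\operatorname{dom}H=\{x: H(x)\neq+\infty_Y\}$; $H$ is proper if $\operatorname{dom}H\ne\emptyset$; $H$ is $K$-convex if $\{(x,y)\in X\times Y: H(x)\leqq_K y\}$ is convex. The same definitions are used for $G$ with $Z,S$ in place of $Y,K$. A mapping is continuous at $x$ if its value at $x$ is finite (in $Y$, resp. $Z$) and every neighbourhood of this value contains the image of some neighbourhood of $x$. $I_D(x)=0_Y$ if $x\in D$, $+\infty_Y$ otherwise. $\mathcal{L}(X,Y)$ is the space of continuous linear mappings $X\to Y$, and $\mathcal{L}_+(S,K):=\{T\in\mathcal{L}(Z,Y): T(S)\subset K\}$. $(T\circ G)(x):=+\infty_Y$ when $G(x)=+\infty_Z$. The conjugate of $H$ is $H^*(L):=\operatorname{WSup}\{L(x)-H(x): x\in X\}$, $L\in\mathcal{L}(X,Y)$. *)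

theory Defs
  imports "HOL-Analysis.Analysis" "HOL-Library.Extended" "HOL-Library.Set_Algebras"
begin

class real_tvs = topological_ab_group_add + real_vector +
  assumes tendsto_scaleR_Pair:
    "LIM p (nhds a \<times>\<^sub>F nhds x). fst p *\<^sub>R snd p :> nhds (a *\<^sub>R x)"

text \<open>Convexity is spelled out because \<^const>\<open>convex\<close> cannot be used in a class specification.\<close>

class locally_convex_t2 = real_tvs + t2_space +
  assumes convex_nhds_0_raw:
    "\<lbrakk>open U; 0 \<in> U\<rbrakk> \<Longrightarrow>
       \<exists>V. open V \<and> 0 \<in> V \<and> V \<subseteq> U \<and>
         (\<forall>x\<in>V. \<forall>y\<in>V. \<forall>u\<ge>0. \<forall>v\<ge>0. u + v = 1 \<longrightarrow> u *\<^sub>R x + v *\<^sub>R y \<in> V)"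

lemma convex_nhds_0:
  fixes U :: "'a::locally_convex_t2 set"
  shows "\<lbrakk>open U; 0 \<in> U\<rbrakk> \<Longrightarrow> \<exists>V. open V \<and> convex V \<and> 0 \<in> V \<and> V \<subseteq> U"
  using convex_nhds_0_raw[of U] unfolding convex_def by blast

instance real_normed_vector \<subseteq> locally_convex_t2
proof
  fix a :: real and x :: 'a
  show "LIM p (nhds a \<times>\<^sub>F nhds x). fst p *\<^sub>R snd p :> nhds (a *\<^sub>R x)"
    by (intro tendsto_scaleR filterlim_fst filterlim_snd)
next
  fix U :: "'a set"
  assume "open U" "0 \<in> U"
  then obtain e where "e > 0" "ball 0 e \<subseteq> U"
    by (meson openE)
  moreover have "convex (ball (0::'a) e)"
    by (rule convex_ball)
  ultimately show "\<exists>V. open V \<and> 0 \<in> V \<and> V \<subseteq> U \<and>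
      (\<forall>x\<in>V. \<forall>y\<in>V. \<forall>u\<ge>0. \<forall>v\<ge>0. u + v = 1 \<longrightarrow> u *\<^sub>R x + v *\<^sub>R y \<in> V)"
    unfolding convex_def by (intro exI[of _ "ball 0 e"]) auto
qed

text \<open>
  The space $Y$ with two infinities adjoined is \<^typ>\<open>'y extended\<close>; its library addition and
  negation obey the usual conventions. The library totalizes $(+\infty)+(-\infty)$, which is left
  undefined in the mathematics; no such sum is formed below as long as proper mappings with
  values in $Y \cup \{+\infty\}$ are considered. The library order on \<^typ>\<open>'y extended\<close> plays no
  role here, it is replaced by the orders induced by a cone \<open>K\<close>.
\<close>

fun cone_less :: "'y::locally_convex_t2 set \<Rightarrow> 'y extended \<Rightarrow> 'y extended \<Rightarrow> bool" where
  "cone_less K (Fin a) (Fin b) \<longleftrightarrow> a - b \<in> uminus ` interior K"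
| "cone_less K (Fin a) Pinf \<longleftrightarrow> True"
| "cone_less K Minf (Fin b) \<longleftrightarrow> True"
| "cone_less K Minf Pinf \<longleftrightarrow> True"
| "cone_less K Pinf _ \<longleftrightarrow> False"
| "cone_less K _ Minf \<longleftrightarrow> False"

fun cone_le :: "'y::locally_convex_t2 set \<Rightarrow> 'y extended \<Rightarrow> 'y extended \<Rightarrow> bool" where
  "cone_le K (Fin a) (Fin b) \<longleftrightarrow> a - b \<in> uminus ` K"
| "cone_le K _ Pinf \<longleftrightarrow> True"
| "cone_le K Minf _ \<longleftrightarrow> True"
| "cone_le K Pinf (Fin _) \<longleftrightarrow> False"
| "cone_le K Pinf Minf \<longleftrightarrow> False"
| "cone_le K (Fin _) Minf \<longleftrightarrow> False"

definition WSup :: "'y::locally_convex_t2 set \<Rightarrow> 'y extended set \<Rightarrow> 'y extended set" where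
  "WSup K M = {w. (\<forall>v\<in>M. \<not> cone_less K w v) \<and>
                  (\<forall>u. cone_less K u w \<longrightarrow> (\<exists>v\<in>M. cone_less K u v))}"

text \<open>
  On sets, \<open>U + V\<close> is the elementwise sum from \<^theory>\<open>HOL-Library.Set_Algebras\<close>, whereas
  \<open>U - V\<close> is set difference; hence a separate constant for elementwise differences.
\<close>

definition set_diff :: "'y::ab_group_add extended set \<Rightarrow> 'y extended set \<Rightarrow> 'y extended set" where
  "set_diff U V = {u - v | u v. u \<in> U \<and> v \<in> V}"

text \<open>
  The WS-sum, meaningful for sets \<open>U\<close>, \<open>V\<close> that are \<open>{Pinf}\<close> or consist of finite
  points and split $Y$ into the disjoint parts $U - \mathrm{int} K$, $U$, $U + \mathrm{int} K$.
  Conjugates of proper mappings always are of this form.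
\<close>

definition WS_sum :: "'y::locally_convex_t2 set \<Rightarrow> 'y extended set \<Rightarrow> 'y extended set \<Rightarrow> 'y extended set"
  where "WS_sum K U V = WSup K (U + V)"

definition edom :: "('x \<Rightarrow> 'y extended) \<Rightarrow> 'x set" where
  "edom H = {x. H x \<noteq> Pinf}"

text \<open>A mapping into $Y \cup \{+\infty\}$ with nonempty domain.\<close>

definition proper_map_ext :: "('x \<Rightarrow> 'y extended) \<Rightarrow> bool" where
  "proper_map_ext H \<longleftrightarrow> Minf \<notin> range H \<and> edom H \<noteq> {}"

definition cone_convex :: "'y::locally_convex_t2 set \<Rightarrow> ('x::real_vector \<Rightarrow> 'y extended) \<Rightarrow> bool" where
  "cone_convex K H \<longleftrightarrow> convex {(x, y). cone_le K (H x) (Fin y)}"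

definition continuous_at_ext ::
  "('x::topological_space \<Rightarrow> 'y::topological_space extended) \<Rightarrow> 'x \<Rightarrow> bool" where
  "continuous_at_ext H x \<longleftrightarrow>
     (\<exists>h. H x = Fin h \<and>
        (\<forall>V. open V \<and> h \<in> V \<longrightarrow> (\<exists>U. open U \<and> x \<in> U \<and> H ` U \<subseteq> Fin ` V)))"

definition indicator_map :: "'x set \<Rightarrow> 'x \<Rightarrow> 'y::zero extended" where
  "indicator_map D x = (if x \<in> D then Fin 0 else Pinf)"

definition cont_lin :: "('x::locally_convex_t2 \<Rightarrow> 'y::locally_convex_t2) set" where
  "cont_lin = {L. linear L \<and> continuous_on UNIV L}"

definition pos_cont_lin ::
  "'z::locally_convex_t2 set \<Rightarrow> 'y::locally_convex_t2 set \<Rightarrow> ('z \<Rightarrow> 'y) set" where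
  "pos_cont_lin S K = {T \<in> cont_lin. T ` S \<subseteq> K}"

text \<open>\<^const>\<open>map_extended\<close> fixes both infinities, so this is $+\infty_Y$ where \<open>G\<close> is $+\infty_Z$.\<close>

definition comp_ext :: "('z \<Rightarrow> 'y) \<Rightarrow> ('x \<Rightarrow> 'z extended) \<Rightarrow> 'x \<Rightarrow> 'y extended" where
  "comp_ext T G x = map_extended T (G x)"

definition conj_map ::
  "'y::locally_convex_t2 set \<Rightarrow> ('x \<Rightarrow> 'y extended) \<Rightarrow> ('x \<Rightarrow> 'y) \<Rightarrow> 'y extended set" where
  "conj_map K H L = WSup K (range (\<lambda>x. Fin (L x) - H x))"

end

theory Submission
  imports Defs
begin

text \<open>
  Why the equivalences hold. A weak supremum is known once one knows which points of \<open>Y\<close> lie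
  strictly below some element: \<open>M\<close> and its weak supremum have the same strict lower set
  (\<open>strict_lower_WSup\<close>: move up a ray in an interior direction until it leaves the strict lower
  set of \<open>M\<close>; the exit point belongs to the weak supremum, and if the ray never leaves,
  \<open>+\<infinity>\<close> does). Strict lower sets turn elementwise sums into elementwise sums
  (\<open>strict_lower_add\<close>). Hence each dual condition \<open>\<beta>\<close>, finiteness clause included,
  says only that \<open>y\<close> is not in the sum of the strict lower sets of the sets whose weak suprema
  are the conjugates: there are no points, one for each of the mappings, at which the values of
  \<open>L' - F\<close> and its companions add up to something strictly above \<open>y\<close>.

  In this form, each \<open>\<beta>\<close> implies \<open>\<alpha>\<close> by weak duality: at a feasible point \<open>x\<close> that
  violates \<open>\<alpha>\<close>, the term \<open>T (G x)\<close> is in \<open>- K\<close>, and \<open>x\<close> taken as the point for every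
  mapping violates \<open>\<beta>\<close> (\<open>conj_lower_add\<close>).

  For the converse, \<open>\<alpha>\<close> is scalarized. The set of pairs dominating
  \<open>(F x - L x + y, G x)\<close> with \<open>x\<close> in \<open>C\<close> is convex, and \<open>\<alpha>\<close> keeps it away from
  \<open>(- interior K) \<times> {0}\<close>. Separation gives functionals \<open>f\<close> and \<open>g\<close>, nonnegative
  on \<open>K\<close> and \<open>S\<close>, with \<open>f (F x - L x + y) + g (G x) \<ge> 0\<close> on \<open>C\<close>; the Slater point
  ensures \<open>f \<noteq> 0\<close> (\<open>Slater_multipliers\<close>, \<open>Lagrange_multipliers\<close>). With \<open>b\<close> in the
  interior of \<open>K\<close> and \<open>f b = 1\<close>, the rank-one map \<open>T z = g z b\<close> is the multiplier, since
  \<open>f\<close> is positive on the interior of \<open>K\<close> and so detects the strict order. Under the continuity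
  conditions, the scalar inequality is split by a sandwich theorem (\<open>convex_sandwich\<close>), first into
  an inequality for \<open>f \<circ> F\<close> and one for the rest, and then the rest into one for \<open>g \<circ> G\<close>
  and one for \<open>C\<close>. The scalar functionals \<open>\<phi>\<close> and \<open>\<psi>\<close> obtained become the operators
  \<open>- \<phi> b\<close> and \<open>\<psi> b\<close>.

  Both separation arguments are instances of one algebraic statement, \<open>separation_at_core_point\<close>,
  proved by enlarging a convex cone until it contains \<open>x\<close> or \<open>- x\<close> for every \<open>x\<close>.
\<close>

section \<open>Separation in real vector spaces\<close>

lemma convex_cone_addD:
  assumes "convex P" "cone P" "x \<in> P" "y \<in> P"
  shows "x + y \<in> P"
  using assms convex_cone[of P] by blast

text \<open>
  If neither \<open>x\<close> nor \<open>- x\<close> could be adjoined to \<open>P\<close> without creating \<open>- e\<close>, then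
  \<open>- e\<close> would equal \<open>p + s x\<close> and also \<open>q - t x\<close> with \<open>s\<close>, \<open>t\<close> positive;
  eliminating \<open>x\<close> puts a negative multiple of \<open>e\<close> into \<open>P\<close>.
\<close>

lemma total_convex_cone:
  fixes e :: "'a::real_vector"
  assumes P: "convex P" "cone P" "e \<in> P" "- e \<notin> P"
    and maximal: "\<And>Q. \<lbrakk>convex Q; cone Q; P \<subseteq> Q; - e \<notin> Q\<rbrakk> \<Longrightarrow> Q = P"
  shows "x \<in> P \<or> - x \<in> P"
proof (rule ccontr)
  assume neither: "\<not> (x \<in> P \<or> - x \<in> P)"
  have zero: "0 \<in> P" using P(2,3) cone_contains_0 by blast
  have adjoin: "\<exists>s>0. \<exists>p\<in>P. p + s *\<^sub>R z = - e" if "z \<notin> P" for z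
  proof -
    define Q where "Q = {p + s *\<^sub>R z | p s. p \<in> P \<and> s \<ge> 0}"
    have "z \<in> Q" unfolding Q_def using zero by (force intro: exI[of _ 0] exI[of _ "1::real"])
    moreover have "P \<subseteq> Q" unfolding Q_def by (force intro: exI[of _ "0::real"])
    moreover have "convex Q \<and> cone Q"
      unfolding convex_cone
    proof (intro conjI ballI allI impI)
      fix u v assume "u \<in> Q" "v \<in> Q"
      then obtain p s q t where "u = p + s *\<^sub>R z" "v = q + t *\<^sub>R z" "p \<in> P" "q \<in> P" "s \<ge> 0" "t \<ge> 0"
        unfolding Q_def by blast
      then have "u + v = (p + q) + (s + t) *\<^sub>R z" "p + q \<in> P" "s + t \<ge> 0"
        using P by (auto simp: scaleR_add_left intro: convex_cone_addD)
      then show "u + v \<in> Q" unfolding Q_def by blast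
    next
      fix u and c :: real assume "u \<in> Q" "0 \<le> c"
      then obtain p s where "u = p + s *\<^sub>R z" "p \<in> P" "s \<ge> 0" unfolding Q_def by blast
      then have "c *\<^sub>R u = c *\<^sub>R p + (c * s) *\<^sub>R z" "c *\<^sub>R p \<in> P" "c * s \<ge> 0"
        using P(2) \<open>0 \<le> c\<close> by (auto simp: scaleR_add_right mem_cone)
      then show "c *\<^sub>R u \<in> Q" unfolding Q_def by blast
    qed
    ultimately have "- e \<in> Q" using maximal[of Q] that by blast
    then obtain p s where ps: "- e = p + s *\<^sub>R z" "p \<in> P" "s \<ge> 0" unfolding Q_def by blast
    moreover have "s \<noteq> 0" using ps P(4) by force
    ultimately show ?thesis by (metis order_le_less)
  qed
  obtain s p where s: "s > 0" "p \<in> P" "p + s *\<^sub>R x = - e" using adjoin neither by blast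
  obtain t q where t: "t > 0" "q \<in> P" "q + t *\<^sub>R (- x) = - e" using adjoin neither by blast
  have "t *\<^sub>R p + s *\<^sub>R q = t *\<^sub>R (p + s *\<^sub>R x) + s *\<^sub>R (q + t *\<^sub>R (- x))"
    by (simp add: algebra_simps)
  also have "\<dots> = (s + t) *\<^sub>R (- e)" unfolding s(3) t(3) by (simp add: algebra_simps)
  finally have "(s + t) *\<^sub>R (- e) \<in> P"
    using P s t by (metis convex_cone_addD mem_cone less_imp_le)
  then have "(1 / (s + t)) *\<^sub>R (s + t) *\<^sub>R (- e) \<in> P"
    by (rule mem_cone[OF P(2)]) (use s t in simp)
  moreover have "(1 / (s + t)) *\<^sub>R (s + t) *\<^sub>R (- e) = - e" using s t by simp
  ultimately show False using P(4) by simp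
qed

text \<open>
  The cone is the nonnegative part of a total preorder with order unit \<open>e\<close>, and the functional
  measures \<open>x\<close> by the least multiple of \<open>e\<close> above it. This gauge is sublinear for any such
  cone; totality makes it odd, hence linear.
\<close>

lemma total_cone_functional:
  fixes e :: "'a::real_vector"
  assumes P: "convex P" "cone P" "e \<in> P" "- e \<notin> P"
    and total: "\<And>x. x \<in> P \<or> - x \<in> P"
    and unit: "\<And>x. \<exists>t. t *\<^sub>R e + x \<in> P"
  shows "\<exists>f::'a \<Rightarrow> real. linear f \<and> f e = 1 \<and> (\<forall>x\<in>P. 0 \<le> f x)"
proof -
  define A where "A x = {t. t *\<^sub>R e - x \<in> P}" for x
  define f where "f x = Inf (A x)" for x
  have nonneg: "t \<ge> 0" if "t *\<^sub>R e \<in> P" for t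
  proof (rule ccontr)
    assume "\<not> t \<ge> 0"
    then have "t < 0" by simp
    then have "(1 / - t) *\<^sub>R t *\<^sub>R e \<in> P"
      by (intro mem_cone[OF P(2) that]) simp
    moreover have "(1 / - t) *\<^sub>R t *\<^sub>R e = - e" using \<open>t < 0\<close> by simp
    ultimately show False using P(4) by simp
  qed
  have ne: "A x \<noteq> {}" for x using unit[of "- x"] unfolding A_def by auto
  have below: "- s \<le> t" if "s *\<^sub>R e + x \<in> P" "t \<in> A x" for s t x
  proof -
    have "(s + t) *\<^sub>R e = (s *\<^sub>R e + x) + (t *\<^sub>R e - x)" by (simp add: algebra_simps)
    also have "\<dots> \<in> P" using that P convex_cone_addD unfolding A_def by blast
    finally show ?thesis using nonneg by fastforce
  qed
  have bdd: "bdd_below (A x)" for x using below unit[of x] by (meson bdd_belowI)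
  have lower: "f x \<le> t" if "t \<in> A x" for x t
    unfolding f_def using that bdd by (rule cInf_lower)
  have greatest: "c \<le> f x" if "\<And>t. t \<in> A x \<Longrightarrow> c \<le> t" for x c
    unfolding f_def using ne that by (rule cInf_greatest)
  have subadd: "f (x + y) \<le> f x + f y" for x y
  proof -
    have *: "s + t \<in> A (x + y)" if "s \<in> A x" "t \<in> A y" for s t
      using convex_cone_addD[of P, OF P(1,2), of "s *\<^sub>R e - x" "t *\<^sub>R e - y"] that
      unfolding A_def by (simp add: algebra_simps)
    have "f (x + y) - f y \<le> f x"
    proof (rule greatest)
      fix s assume s: "s \<in> A x"
      have "f (x + y) - s \<le> f y"
        by (rule greatest) (use lower[OF *[OF s]] in force)
      then show "f (x + y) - f y \<le> s" by simp
    qed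
    then show ?thesis by simp
  qed
  have scale: "f (c *\<^sub>R x) \<le> c * f x" if "c > 0" for c x
  proof -
    have "f (c *\<^sub>R x) / c \<le> f x"
    proof (rule greatest)
      fix t assume "t \<in> A x"
      then have "c *\<^sub>R (t *\<^sub>R e - x) \<in> P" unfolding A_def using P(2) that by (simp add: mem_cone)
      then have "c * t \<in> A (c *\<^sub>R x)" unfolding A_def by (simp add: algebra_simps)
      then show "f (c *\<^sub>R x) / c \<le> t" using lower that by (simp add: field_simps)
    qed
    then show ?thesis using that by (simp add: field_simps)
  qed
  have on_P: "0 \<le> f x" if "x \<in> P" for x
    using below[of 0 x] that by (intro greatest) auto
  have f0: "f 0 = 0"
  proof (rule antisym)
    show "f 0 \<le> 0" by (rule lower) (use P(2,3) cone_contains_0 in \<open>auto simp: A_def\<close>)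
    show "0 \<le> f 0" by (rule on_P) (use P(2,3) cone_contains_0 in blast)
  qed
  have odd: "f (- x) = - f x" for x
  proof (rule antisym)
    have "f (- x) \<le> - t" if "t < f x" for t
    proof -
      have "t *\<^sub>R e - x \<notin> P" using that lower[of t x] unfolding A_def by auto
      then have "- (t *\<^sub>R e - x) \<in> P" using total by blast
      then show ?thesis by (intro lower) (simp add: A_def)
    qed
    then have "t \<le> - f (- x)" if "t < f x" for t using that by force
    then show "f (- x) \<le> - f x" using dense_le by fastforce
    show "- f x \<le> f (- x)" using subadd[of x "- x"] f0 by simp
  qed
  have add: "f (x + y) = f x + f y" for x y
    using subadd[of x y] subadd[of "- x" "- y"] odd[of x] odd[of y] odd[of "x + y"] by simp
  have pos_scale: "f (c *\<^sub>R x) = c * f x" if "c > 0" for c x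
    using scale[OF that, of x] scale[OF that, of "- x"] odd[of x] odd[of "c *\<^sub>R x"] by simp
  have "f (c *\<^sub>R x) = c * f x" for c x
  proof (cases c "0::real" rule: linorder_cases)
    case less
    then have "f (c *\<^sub>R x) = - f ((- c) *\<^sub>R x)" using odd[of "c *\<^sub>R x"] by simp
    then show ?thesis using pos_scale[of "- c" x] less by simp
  qed (auto simp: f0 pos_scale)
  then have "linear f" using add by (intro linearI) auto
  moreover have "f e = 1"
  proof (rule antisym)
    have "1 \<in> A e" using P(2,3) cone_contains_0 by (auto simp: A_def)
    then show "f e \<le> 1" by (rule lower)
    show "1 \<le> f e"
    proof (rule greatest)
      fix t assume "t \<in> A e"
      then have "(t - 1) *\<^sub>R e \<in> P" by (simp add: A_def algebra_simps)
      then show "1 \<le> t" using nonneg by fastforce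
    qed
  qed
  ultimately show ?thesis using on_P by blast
qed

text \<open>
  By Zorn's lemma \<open>W\<close> is contained in a convex cone that is maximal among those without \<open>- e\<close>;
  maximality makes it total, and it inherits the order unit.
\<close>

lemma order_unit_functional:
  fixes e :: "'a::real_vector"
  assumes W: "convex W" "cone W" "e \<in> W" "- e \<notin> W"
    and unit: "\<And>x. \<exists>t. t *\<^sub>R e + x \<in> W"
  shows "\<exists>f::'a \<Rightarrow> real. linear f \<and> f e = 1 \<and> (\<forall>x\<in>W. 0 \<le> f x)"
proof -
  define Cs where "Cs = {P. convex P \<and> cone P \<and> W \<subseteq> P \<and> - e \<notin> P}"
  have "\<exists>P\<in>Cs. \<forall>Q\<in>Cs. P \<subseteq> Q \<longrightarrow> Q = P"
  proof (rule subset_Zorn_nonempty)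
    show "Cs \<noteq> {}" using W unfolding Cs_def by blast
    fix Ch assume ne: "Ch \<noteq> {}" and chain: "subset.chain Cs Ch"
    have mem: "P \<in> Cs" if "P \<in> Ch" for P using chain that by (auto simp: subset_chain_def)
    have "convex (\<Union>Ch) \<and> cone (\<Union>Ch)"
      unfolding convex_cone
    proof (intro conjI ballI allI impI)
      fix u v assume "u \<in> \<Union>Ch" "v \<in> \<Union>Ch"
      then obtain P where "P \<in> Ch" "u \<in> P" "v \<in> P"
        using chain unfolding subset_chain_def by blast
      then show "u + v \<in> \<Union>Ch" using mem[of P] convex_cone_addD[of P u v] unfolding Cs_def by blast
    next
      fix u and c :: real assume "u \<in> \<Union>Ch" "0 \<le> c"
      then show "c *\<^sub>R u \<in> \<Union>Ch" using mem mem_cone unfolding Cs_def by blast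
    qed
    then show "\<Union>Ch \<in> Cs" using mem ne unfolding Cs_def by blast
  qed
  then obtain P where P: "P \<in> Cs" and maximal: "\<And>Q. \<lbrakk>Q \<in> Cs; P \<subseteq> Q\<rbrakk> \<Longrightarrow> Q = P" by blast
  have PP: "convex P" "cone P" "e \<in> P" "- e \<notin> P" "W \<subseteq> P"
    using P W unfolding Cs_def by auto
  have "x \<in> P \<or> - x \<in> P" for x
    by (rule total_convex_cone[OF PP(1-4)]) (use maximal PP in \<open>auto simp: Cs_def\<close>)
  moreover have "\<exists>t. t *\<^sub>R e + x \<in> P" for x using unit PP(5) by blast
  ultimately show ?thesis using total_cone_functional[OF PP(1-4)] PP(5) by blast
qed

text \<open>
  The cone generated by \<open>D\<close> has the algebraic interior point \<open>e\<close> as order unit, and it misses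
  \<open>- e\<close> because \<open>D\<close> misses the ray opposite to \<open>e\<close>. The normalization \<open>f e = 1\<close> is
  essential for the applications: there \<open>e\<close> lies in one factor of a product space, and the
  functional must not vanish on that factor.
\<close>

lemma separation_at_core_point:
  fixes e :: "'a::real_vector"
  assumes "convex D" "e \<noteq> 0"
    and core: "\<And>v. \<exists>s>0. e + s *\<^sub>R v \<in> D"
    and avoid: "\<And>t. t < 0 \<Longrightarrow> t *\<^sub>R e \<notin> D"
  shows "\<exists>f::'a \<Rightarrow> real. linear f \<and> f e = 1 \<and> (\<forall>x\<in>D. 0 \<le> f x)"
proof -
  define W where "W = cone hull D"
  have W: "convex W" "cone W" "D \<subseteq> W"
    unfolding W_def using assms(1) by (auto simp: convex_cone_hull cone_cone_hull hull_inc)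
  have "e \<in> W" using core[of 0] W(3) by auto
  moreover have "- e \<notin> W"
  proof
    assume "- e \<in> W"
    then obtain c d where cd: "- e = c *\<^sub>R d" "c \<ge> 0" "d \<in> D" unfolding W_def cone_hull_expl by blast
    have "c > 0" using cd \<open>e \<noteq> 0\<close> by (cases "c = 0") auto
    have "(- 1 / c) *\<^sub>R e = (1 / c) *\<^sub>R (- e)" by simp
    also have "\<dots> = d" unfolding cd(1) using \<open>c > 0\<close> by simp
    finally have "d = (- 1 / c) *\<^sub>R e" by simp
    then show False using avoid[of "- 1 / c"] cd(3) \<open>c > 0\<close> by simp
  qed
  moreover have "\<exists>t. t *\<^sub>R e + v \<in> W" for v
  proof -
    obtain s where s: "s > 0" "e + s *\<^sub>R v \<in> D" using core by blast
    then have "(1 / s) *\<^sub>R (e + s *\<^sub>R v) \<in> W" using W by (intro mem_cone) auto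
    then show ?thesis using s(1) by (auto simp: scaleR_add_right)
  qed
  ultimately show ?thesis using order_unit_functional[OF W(1,2)] W(3) by blast
qed

section \<open>Topological vector spaces\<close>

lemma tendsto_scaleR_tvs:
  fixes g :: "'b \<Rightarrow> 'a::real_tvs"
  assumes "(f \<longlongrightarrow> a) F" "(g \<longlongrightarrow> x) F"
  shows "((\<lambda>t. f t *\<^sub>R g t) \<longlongrightarrow> a *\<^sub>R x) F"
  using filterlim_compose[OF tendsto_scaleR_Pair filterlim_Pair[OF assms]] by simp

lemma continuous_on_scaleR_tvs:
  fixes g :: "'b::topological_space \<Rightarrow> 'a::real_tvs"
  assumes "continuous_on X f" "continuous_on X g"
  shows "continuous_on X (\<lambda>t. f t *\<^sub>R g t)"
  using assms unfolding continuous_on_def by (auto intro: tendsto_scaleR_tvs)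

lemma open_affine_vimage:
  fixes U :: "'a::real_tvs set"
  assumes "open U"
  shows "open {x. c *\<^sub>R x + a \<in> U}"
proof -
  have "continuous_on UNIV (\<lambda>x::'a. c *\<^sub>R x + a)"
    by (intro continuous_on_add continuous_on_scaleR_tvs continuous_on_const continuous_on_id)
  then show ?thesis using open_vimage[OF assms] by (simp add: vimage_def)
qed

lemma open_contains_small_steps:
  fixes x :: "'a::real_tvs"
  assumes "open U" "x \<in> U"
  shows "\<exists>d>0. \<forall>t. 0 < t \<and> t \<le> d \<longrightarrow> x + t *\<^sub>R v \<in> U"
proof -
  have "((\<lambda>t. x + t *\<^sub>R v) \<longlongrightarrow> x + 0 *\<^sub>R v) (at_right 0)"
    by (intro tendsto_add tendsto_const tendsto_scaleR_tvs tendsto_ident_at)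
  then have "eventually (\<lambda>t. x + t *\<^sub>R v \<in> U) (at_right 0)"
    using assms topological_tendstoD by fastforce
  then obtain d where "d > 0" "\<And>t. \<lbrakk>0 < t; t < d\<rbrakk> \<Longrightarrow> x + t *\<^sub>R v \<in> U"
    by (auto simp: eventually_at_right_field)
  then show ?thesis by (intro exI[of _ "d / 2"]) auto
qed

lemma open_contains_step:
  fixes x :: "'a::real_tvs"
  assumes "open U" "x \<in> U"
  shows "\<exists>d>0. x + d *\<^sub>R v \<in> U"
  using open_contains_small_steps[OF assms] by fastforce

text \<open>
  A lower bound on an open set gives, by reflection at one of its points, a two-sided bound
  on a neighbourhood, and scaling makes this bound as small as desired.
\<close>

lemma linear_continuous_if_bounded_below:
  fixes f :: "'a::real_tvs \<Rightarrow> real"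
  assumes "linear f" "open U" "U \<noteq> {}" and low: "\<And>x. x \<in> U \<Longrightarrow> m \<le> f x"
  shows "continuous_on UNIV f"
proof -
  obtain x0 where x0: "x0 \<in> U" using \<open>U \<noteq> {}\<close> by blast
  define b where "b = \<bar>m - f x0\<bar> + 1"
  have "b > 0" unfolding b_def by simp
  have "\<exists>N. open N \<and> a \<in> N \<and> (\<forall>x\<in>N. \<bar>f x - f a\<bar> < r)" if "r > 0" for a r
  proof -
    define c where "c = b / r"
    have c: "c > 0" using \<open>b > 0\<close> that by (simp add: c_def)
    define N where "N = {x. c *\<^sub>R x + (x0 - c *\<^sub>R a) \<in> U} \<inter> {x. (- c) *\<^sub>R x + (x0 + c *\<^sub>R a) \<in> U}"
    have "open N" unfolding N_def using open_affine_vimage[OF \<open>open U\<close>] by blast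
    moreover have "a \<in> N" using x0 by (simp add: N_def)
    moreover have "\<bar>f x - f a\<bar> < r" if "x \<in> N" for x
    proof -
      have "m \<le> f (c *\<^sub>R x + (x0 - c *\<^sub>R a))" "m \<le> f ((- c) *\<^sub>R x + (x0 + c *\<^sub>R a))"
        using that low unfolding N_def by blast+
      then have "m \<le> c * f x + (f x0 - c * f a)" "m \<le> - c * f x + (f x0 + c * f a)"
        using linear_add[OF \<open>linear f\<close>] linear_diff[OF \<open>linear f\<close>] linear_scale[OF \<open>linear f\<close>]
        by auto
      then have "c * (f x - f a) < b" "- (c * (f x - f a)) < b"
        unfolding b_def by (auto simp: algebra_simps)
      then have "\<bar>c * (f x - f a)\<bar> < b" by linarith
      then have "c * \<bar>f x - f a\<bar> < b" using c by (simp add: abs_mult)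
      then show ?thesis using \<open>r > 0\<close> \<open>b > 0\<close> by (simp add: c_def field_simps)
    qed
    ultimately show ?thesis by blast
  qed
  then have "(f \<longlongrightarrow> f a) (at a)" for a
    unfolding tendsto_iff dist_real_def eventually_at_topological by metis
  then show ?thesis by (simp add: continuous_on_def)
qed

section \<open>Solid cones\<close>

lemma cone_interior_add:
  fixes K :: "'a::real_tvs set"
  assumes "convex K" "cone K" "p \<in> interior K" "q \<in> K"
  shows "p + q \<in> interior K"
proof -
  have "{x. 1 *\<^sub>R x + (- q) \<in> interior K} \<subseteq> K"
  proof
    fix x assume "x \<in> {x. 1 *\<^sub>R x + (- q) \<in> interior K}"
    then have "x - q \<in> K" using interior_subset[of K] by auto
    then have "(x - q) + q \<in> K"
      by (rule convex_cone_addD[OF assms(1,2) _ \<open>q \<in> K\<close>])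
    then show "x \<in> K" by simp
  qed
  then have "{x. 1 *\<^sub>R x + (- q) \<in> interior K} \<subseteq> interior K"
    by (intro interior_maximal open_affine_vimage open_interior)
  then show ?thesis using \<open>p \<in> interior K\<close> by auto
qed

lemma cone_interior_scale:
  fixes K :: "'a::real_tvs set"
  assumes "cone K" "p \<in> interior K" "t > 0"
  shows "t *\<^sub>R p \<in> interior K"
proof -
  have "{x. (1 / t) *\<^sub>R x + 0 \<in> interior K} \<subseteq> K"
  proof
    fix x assume "x \<in> {x. (1 / t) *\<^sub>R x + 0 \<in> interior K}"
    then have "t *\<^sub>R (1 / t) *\<^sub>R x \<in> K"
      using interior_subset[of K] mem_cone[OF \<open>cone K\<close>] \<open>t > 0\<close> by (metis add_0_right less_imp_le mem_Collect_eq subsetD)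
    then show "x \<in> K" using \<open>t > 0\<close> by simp
  qed
  then have "{x. (1 / t) *\<^sub>R x + 0 \<in> interior K} \<subseteq> interior K"
    by (intro interior_maximal open_affine_vimage open_interior)
  then show ?thesis using assms by auto
qed

lemma cone_interior_absorbs:
  fixes K :: "'a::real_tvs set"
  assumes "cone K" "k \<in> interior K"
  shows "\<exists>n>0. n *\<^sub>R k + v \<in> interior K"
proof -
  obtain d where d: "d > 0" "k + d *\<^sub>R v \<in> interior K"
    using open_contains_step[OF open_interior assms(2)] by blast
  then have "(1 / d) *\<^sub>R (k + d *\<^sub>R v) \<in> interior K"
    using cone_interior_scale[OF assms(1)] by simp
  then show ?thesis using d(1) by (auto simp: scaleR_add_right intro!: exI[of _ "1 / d"])
qed

text \<open>
  Nonnegative functionals detect the strict order: \<open>p - d b\<close> remains in the cone for small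
  \<open>d\<close>, so \<open>f p\<close> is at least \<open>d\<close> times \<open>f b\<close>.
\<close>

lemma cone_functional_pos_interior:
  fixes K :: "'a::real_tvs set" and f :: "'a \<Rightarrow> real"
  assumes "linear f" "\<And>k. k \<in> K \<Longrightarrow> 0 \<le> f k" "f b > 0" "p \<in> interior K"
  shows "f p > 0"
proof -
  obtain d where d: "d > 0" "p + d *\<^sub>R (- b) \<in> interior K"
    using open_contains_step[OF open_interior assms(4)] by blast
  then have "0 \<le> f (p - d *\<^sub>R b)" using assms(2) interior_subset[of K] by auto
  then have "d * f b \<le> f p" using linear_diff[OF assms(1)] linear_scale[OF assms(1)] by simp
  then show ?thesis using mult_pos_pos[OF d(1) assms(3)] by simp
qed

locale solid_cone =
  fixes K :: "'y::locally_convex_t2 set"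
  assumes convex_K: "convex K" and cone_K: "cone K"
    and proper_K: "K \<noteq> UNIV" and solid_K: "interior K \<noteq> {}"
begin

lemma zero_notin_interior: "0 \<notin> interior K"
proof
  assume z: "0 \<in> interior K"
  have "v \<in> K" for v
    using cone_interior_absorbs[OF cone_K z, of v] interior_subset[of K] by auto
  then show False using proper_K by blast
qed

lemma cone_less_Fin: "cone_less K (Fin a) (Fin b) \<longleftrightarrow> b - a \<in> interior K"
proof -
  have "a - b \<in> uminus ` interior K \<longleftrightarrow> - (a - b) \<in> interior K"
    by (metis image_iff minus_minus)
  then show ?thesis by simp
qed

lemma Fin_cone_less_cases:
  assumes "cone_less K (Fin a) w"
  obtains b where "w = Fin b" "b - a \<in> interior K" | "w = Pinf"
  using assms by (cases w) (auto simp: cone_less_Fin simp del: cone_less.simps(1))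

lemma interior_add_interior: "p \<in> interior K \<Longrightarrow> q \<in> interior K \<Longrightarrow> p + q \<in> interior K"
  using cone_interior_add[OF convex_K cone_K] interior_subset[of K] by blast

end

section \<open>Elementwise sums in the extended space\<close>

lemma set_diff_set_diff:
  fixes M U V :: "'a::ab_group_add extended set"
  assumes "M \<subseteq> range Fin" "U \<subseteq> range Fin" "V \<subseteq> range Fin"
  shows "set_diff (set_diff M U) V = set_diff M (U + V)"
proof (intro equalityI subsetI)
  fix w assume "w \<in> set_diff (set_diff M U) V"
  then obtain m u v where muv: "w = m - u - v" "m \<in> M" "u \<in> U" "v \<in> V" by (auto simp: set_diff_def)
  then have "w = m - (u + v)" using assms by (auto dest!: subsetD simp: algebra_simps)
  then show "w \<in> set_diff M (U + V)" using muv by (auto simp: set_diff_def)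
next
  fix w assume "w \<in> set_diff M (U + V)"
  then obtain m u v where muv: "w = m - (u + v)" "m \<in> M" "u \<in> U" "v \<in> V"
    by (auto simp: set_diff_def elim!: set_plus_elim)
  then have "w = m - u - v" using assms by (auto dest!: subsetD simp: algebra_simps)
  then show "w \<in> set_diff (set_diff M U) V" using muv by (auto simp: set_diff_def)
qed

lemma set_plus_subset_Fin:
  fixes U V :: "'a::plus extended set"
  assumes "U \<subseteq> range Fin" "V \<subseteq> range Fin"
  shows "U + V \<subseteq> range Fin"
proof
  fix w assume "w \<in> U + V"
  then obtain u v where "w = u + v" "u \<in> range Fin" "v \<in> range Fin"
    using assms by (blast elim: set_plus_elim)
  then obtain a b where "w = Fin a + Fin b" by blast
  then show "w \<in> range Fin" by simp
qed

text \<open>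
  This is how finiteness of a WS-sum passes to its summands: a summand that contains
  \<open>+\<infinity>\<close> has the whole space as strict lower set.
\<close>

lemma set_plus_UNIV:
  fixes A B :: "'a::group_add set"
  assumes "A \<noteq> {}" "B \<noteq> {}" "A = UNIV \<or> B = UNIV"
  shows "A + B = UNIV"
proof -
  obtain a b where ab: "a \<in> A" "b \<in> B" using assms by blast
  have "y \<in> A + B" for y
    using assms(3)
  proof
    assume "A = UNIV"
    then have "(y - b) + b \<in> A + B" using ab by (intro set_plus_intro) auto
    then show ?thesis by simp
  next
    assume "B = UNIV"
    then have "a + (- a + y) \<in> A + B" using ab by (intro set_plus_intro) auto
    then show ?thesis by simp
  qed
  then show ?thesis by blast
qed

lemma set_plus_nonempty: "A \<noteq> {} \<Longrightarrow> B \<noteq> {} \<Longrightarrow> A + B \<noteq> ({} :: 'a::plus set)"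
  by (auto simp: set_plus_def)

lemma extended_add_eq_Fin_iff:
  "u + v = Fin w \<longleftrightarrow> (\<exists>a b. u = Fin a \<and> v = Fin b \<and> w = a + b)"
  by (cases u; cases v) auto

lemma extended_add_neq_Minf: "u \<noteq> Minf \<Longrightarrow> v \<noteq> Minf \<Longrightarrow> u + v \<noteq> Minf"
  by (cases u; cases v) auto

lemma indicator_map_eq_Fin_iff: "indicator_map C x = Fin w \<longleftrightarrow> x \<in> C \<and> w = 0"
  by (auto simp: indicator_map_def)

lemma indicator_map_neq_Minf: "indicator_map C x \<noteq> Minf"
  by (simp add: indicator_map_def)

lemma comp_ext_eq_Fin_iff: "comp_ext T G x = Fin w \<longleftrightarrow> (\<exists>q. G x = Fin q \<and> w = T q)"
  by (cases "G x") (auto simp: comp_ext_def)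

lemma comp_ext_eq_Minf_iff: "comp_ext T G x = Minf \<longleftrightarrow> G x = Minf"
  by (cases "G x") (auto simp: comp_ext_def)

lemmas eq_Fin_iffs = extended_add_eq_Fin_iff indicator_map_eq_Fin_iff comp_ext_eq_Fin_iff

section \<open>The weak supremum is determined by its strict lower set\<close>

context solid_cone
begin

definition strict_lower :: "'y extended set \<Rightarrow> 'y set" where
  "strict_lower M = {y. \<exists>v\<in>M. cone_less K (Fin y) v}"

lemma strict_lower_downward:
  assumes "a \<in> strict_lower M" "a - b \<in> interior K"
  shows "b \<in> strict_lower M"
proof -
  obtain v where v: "v \<in> M" "cone_less K (Fin a) v" using assms(1) by (auto simp: strict_lower_def)
  from v(2) have "cone_less K (Fin b) v"
  proof (cases rule: Fin_cone_less_cases)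
    case (1 c)
    then have "(c - a) + (a - b) \<in> interior K" using interior_add_interior assms(2) by blast
    then show ?thesis using 1 by (simp add: cone_less_Fin del: cone_less.simps)
  qed simp
  then show ?thesis using v(1) by (auto simp: strict_lower_def)
qed

lemma strict_lower_open:
  assumes "a \<in> strict_lower M"
  shows "\<exists>d>0. a + d *\<^sub>R k \<in> strict_lower M"
proof -
  obtain v where v: "v \<in> M" "cone_less K (Fin a) v" using assms(1) by (auto simp: strict_lower_def)
  from v(2) have "\<exists>d>0. cone_less K (Fin (a + d *\<^sub>R k)) v"
  proof (cases rule: Fin_cone_less_cases)
    case (1 c)
    then obtain d where "d > 0" "(c - a) + d *\<^sub>R (- k) \<in> interior K"
      using open_contains_step[OF open_interior] by blast
    then show ?thesis using 1 by (auto simp: cone_less_Fin algebra_simps simp del: cone_less.simps(1))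
  qed (auto intro: exI[of _ 1])
  then show ?thesis using v(1) by (auto simp: strict_lower_def)
qed

lemma Pinf_in_WSup:
  assumes "strict_lower M = UNIV"
  shows "Pinf \<in> WSup K M"
  unfolding WSup_def
proof (intro CollectI conjI ballI allI impI)
  fix v :: "'y extended" show "\<not> cone_less K Pinf v" by simp
next
  fix u assume u: "cone_less K u Pinf"
  have ex: "\<exists>v\<in>M. cone_less K (Fin y) v" for y using assms by (auto simp: strict_lower_def)
  show "\<exists>v\<in>M. cone_less K u v"
  proof (cases u)
    case (Fin y) then show ?thesis using ex by blast
  next
    case Pinf then show ?thesis using u by simp
  next
    case Minf
    obtain v where "v \<in> M" "cone_less K (Fin 0) v" using ex by blast
    then have "cone_less K u v" using Minf by (cases v) auto
    then show ?thesis using \<open>v \<in> M\<close> by blast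
  qed
qed

lemma Fin_in_WSup:
  assumes "p \<notin> strict_lower M" "strict_lower M \<noteq> {}"
    and "\<And>q. p - q \<in> interior K \<Longrightarrow> q \<in> strict_lower M"
  shows "Fin p \<in> WSup K M"
  unfolding WSup_def
proof (intro CollectI conjI ballI allI impI)
  fix v assume "v \<in> M" then show "\<not> cone_less K (Fin p) v" using assms(1) by (auto simp: strict_lower_def)
next
  fix u assume u: "cone_less K u (Fin p)"
  show "\<exists>v\<in>M. cone_less K u v"
  proof (cases u)
    case (Fin q)
    then show ?thesis using u assms(3)[of q] by (auto simp: cone_less_Fin strict_lower_def simp del: cone_less.simps(1))
  next
    case Pinf then show ?thesis using u by simp
  next
    case Minf
    obtain a v where "v \<in> M" "cone_less K (Fin a) v" using assms(2) by (auto simp: strict_lower_def)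
    then have "cone_less K u v" using Minf by (cases v) auto
    then show ?thesis using \<open>v \<in> M\<close> by blast
  qed
qed

text \<open>
  Starting at a point \<open>y\<close> strictly below \<open>M\<close>, follow the ray in an interior direction
  \<open>k\<close>. If it stays strictly below \<open>M\<close>, everything is strictly below \<open>M\<close>, because \<open>k\<close> is an
  order unit, and \<open>+\<infinity>\<close> is in the weak supremum. Otherwise the point at which it stops
  being strictly below \<open>M\<close> is in the weak supremum and strictly above \<open>y\<close>.
\<close>

lemma strict_lower_WSup: "strict_lower (WSup K M) = strict_lower M"
proof (intro equalityI subsetI)
  fix y assume "y \<in> strict_lower (WSup K M)"
  then show "y \<in> strict_lower M" by (auto simp: strict_lower_def WSup_def)
next
  fix y assume y: "y \<in> strict_lower M"
  obtain k where k: "k \<in> interior K" using solid_K by blast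
  define A where "A = {t. y + t *\<^sub>R k \<in> strict_lower M}"
  have "0 \<in> A" using y by (simp add: A_def)
  show "y \<in> strict_lower (WSup K M)"
  proof (cases "bdd_above A")
    case False
    have "p \<in> strict_lower M" for p
    proof -
      obtain n where n: "n > 0" "n *\<^sub>R k + (y - p) \<in> interior K"
        using cone_interior_absorbs[OF cone_K k] by blast
      obtain t where t: "t \<in> A" "t > n" using False by (meson bdd_above.I not_le_imp_less)
      have "(n *\<^sub>R k + (y - p)) + (t - n) *\<^sub>R k \<in> interior K"
        using t(2) k by (intro interior_add_interior[OF n(2)] cone_interior_scale[OF cone_K]) auto
      then have "(y + t *\<^sub>R k) - p \<in> interior K" by (simp add: algebra_simps)
      then show ?thesis using t(1) strict_lower_downward unfolding A_def by blast
    qed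
    then have "Pinf \<in> WSup K M" by (intro Pinf_in_WSup) blast
    then show ?thesis by (force simp: strict_lower_def)
  next
    case True
    define s where "s = Sup A"
    have upper: "t \<le> s" if "t \<in> A" for t unfolding s_def using cSup_upper[OF that True] .
    have gap: "\<exists>d>0. t + d \<in> A" if t: "t \<in> A" for t
    proof -
      obtain d where "d > 0" "(y + t *\<^sub>R k) + d *\<^sub>R k \<in> strict_lower M"
        using strict_lower_open t unfolding A_def by blast
      then show ?thesis unfolding A_def by (auto simp: algebra_simps)
    qed
    have "s > 0" using gap[OF \<open>0 \<in> A\<close>] upper by fastforce
    have "s \<notin> A" using gap upper by fastforce
    have "Fin (y + s *\<^sub>R k) \<in> WSup K M"
    proof (rule Fin_in_WSup)
      show "y + s *\<^sub>R k \<notin> strict_lower M" using \<open>s \<notin> A\<close> by (simp add: A_def)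
      show "strict_lower M \<noteq> {}" using y by blast
      fix q assume "(y + s *\<^sub>R k) - q \<in> interior K"
      then obtain d where d: "d > 0" "(y + s *\<^sub>R k - q) + d *\<^sub>R (- k) \<in> interior K"
        using open_contains_step[OF open_interior] by blast
      obtain t where t: "t \<in> A" "t > s - d"
        using less_cSup_iff[of A "s - d"] True \<open>0 \<in> A\<close> d(1) unfolding s_def by auto
      have "((y + s *\<^sub>R k - q) + d *\<^sub>R (- k)) + (t - (s - d)) *\<^sub>R k \<in> interior K"
        using t(2) k by (intro interior_add_interior[OF d(2)] cone_interior_scale[OF cone_K]) auto
      then have "(y + t *\<^sub>R k) - q \<in> interior K" by (simp add: algebra_simps)
      then show "q \<in> strict_lower M" using t(1) strict_lower_downward unfolding A_def by blast
    qed
    moreover have "cone_less K (Fin y) (Fin (y + s *\<^sub>R k))"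
      using cone_interior_scale[OF cone_K k \<open>s > 0\<close>] by (simp add: cone_less_Fin del: cone_less.simps)
    ultimately show ?thesis unfolding strict_lower_def by blast
  qed
qed

text \<open>
  If \<open>y\<close> is strictly below \<open>u + v\<close> with finite \<open>u\<close> and \<open>v\<close>, the gap between them is an interior vector; giving half
  of it to each summand exhibits \<open>y\<close> as a sum of points strictly below \<open>u\<close> and \<open>v\<close>. The
  hypothesis excludes the sum of opposite infinities, whose totalized value \<open>+\<infinity>\<close> would
  have everything below it although nothing is below \<open>-\<infinity>\<close>.
\<close>

lemma strict_lower_add:
  assumes "(Pinf \<notin> U \<and> Pinf \<notin> V) \<or> (Minf \<notin> U \<and> Minf \<notin> V)"
  shows "strict_lower (U + V) = strict_lower U + strict_lower V"
proof (intro equalityI subsetI)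
  fix y assume "y \<in> strict_lower U + strict_lower V"
  then obtain a b u v where ab: "y = a + b" "u \<in> U" "v \<in> V" "cone_less K (Fin a) u" "cone_less K (Fin b) v"
    by (auto simp: strict_lower_def elim!: set_plus_elim)
  have "cone_less K (Fin y) (u + v)"
    using ab(4)
  proof (cases rule: Fin_cone_less_cases)
    case u: (1 a')
    show ?thesis using ab(5)
    proof (cases rule: Fin_cone_less_cases)
      case (1 b')
      then have "(a' - a) + (b' - b) \<in> interior K" using u interior_add_interior by blast
      then show ?thesis using 1 u ab(1) by (simp add: cone_less_Fin algebra_simps del: cone_less.simps(1))
    qed (use u in simp)
  next
    case 2
    then show ?thesis using ab(5) by (cases v) auto
  qed
  then show "y \<in> strict_lower (U + V)" using ab(2,3) by (auto simp: strict_lower_def)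
next
  fix y assume "y \<in> strict_lower (U + V)"
  then obtain u v where uv: "u \<in> U" "v \<in> V" "cone_less K (Fin y) (u + v)"
    by (auto simp: strict_lower_def elim!: set_plus_elim)
  obtain k where k: "k \<in> interior K" using solid_K by blast
  have "\<exists>a b. y = a + b \<and> cone_less K (Fin a) u \<and> cone_less K (Fin b) v"
  proof (cases u)
    case u: (Fin a')
    show ?thesis
    proof (cases v)
      case (Fin b')
      define d where "d = (1/2) *\<^sub>R (a' + b' - y)"
      have d: "d \<in> interior K"
        unfolding d_def using uv(3) u Fin
        by (intro cone_interior_scale cone_K) (auto simp: cone_less_Fin simp del: cone_less.simps(1))
      have "(a' - d) + (b' - d) = y" unfolding d_def by (simp add: algebra_simps flip: scaleR_add_left)
      then show ?thesis using d u Fin by (intro exI[of _ "a' - d"] exI[of _ "b' - d"])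
          (simp add: cone_less_Fin del: cone_less.simps(1))
    next
      case Pinf
      then show ?thesis using k u by (intro exI[of _ "a' - k"] exI[of _ "y - (a' - k)"])
         (simp add: cone_less_Fin del: cone_less.simps(1))
    next
      case Minf then show ?thesis using uv(3) u by simp
    qed
  next
    case u: Pinf
    show ?thesis
    proof (cases v)
      case (Fin b')
      then show ?thesis using k u by (intro exI[of _ "y - (b' - k)"] exI[of _ "b' - k"])
         (simp add: cone_less_Fin del: cone_less.simps(1))
    next
      case Pinf
      then show ?thesis using u by (intro exI[of _ y] exI[of _ 0]) simp
    next
      case Minf then show ?thesis using uv u assms by simp
    qed
  next
    case u: Minf
    then show ?thesis using uv assms by (cases v) auto
  qed
  then show "y \<in> strict_lower U + strict_lower V" using uv(1,2) by (fastforce simp: strict_lower_def)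
qed

lemma Minf_notin_WSup:
  assumes "strict_lower M \<noteq> {}"
  shows "Minf \<notin> WSup K M"
proof -
  obtain a v where "v \<in> M" "cone_less K (Fin a) v" using assms by (auto simp: strict_lower_def)
  then have "cone_less K Minf v" by (cases v) auto
  then show ?thesis using \<open>v \<in> M\<close> by (auto simp: WSup_def)
qed

lemma WSup_finite_iff:
  assumes "strict_lower M \<noteq> {}"
  shows "WSup K M \<subseteq> range Fin \<longleftrightarrow> strict_lower M \<noteq> UNIV"
proof
  assume "WSup K M \<subseteq> range Fin"
  then have "Pinf \<notin> WSup K M" by auto
  then show "strict_lower M \<noteq> UNIV" using Pinf_in_WSup by blast
next
  assume ne: "strict_lower M \<noteq> UNIV"
  have "Pinf \<notin> WSup K M"
  proof
    assume "Pinf \<in> WSup K M"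
    then have "strict_lower (WSup K M) = UNIV" by (force simp: strict_lower_def)
    then show False using ne strict_lower_WSup by simp
  qed
  then show "WSup K M \<subseteq> range Fin" using Minf_notin_WSup[OF assms]
    by (auto simp: image_iff) (metis extended.exhaust)
qed

lemma difference_avoids_iff:
  assumes "U \<subseteq> range Fin"
  shows "set_diff {Fin y} U \<inter> Fin ` uminus ` interior K = {} \<longleftrightarrow> y \<notin> strict_lower U"
proof -
  have *: "Fin y - Fin u \<in> Fin ` uminus ` interior K \<longleftrightarrow> cone_less K (Fin y) (Fin u)" for u
    by auto
  have "set_diff {Fin y} U \<inter> Fin ` uminus ` interior K = {} \<longleftrightarrow>
      (\<forall>u\<in>U. Fin y - u \<notin> Fin ` uminus ` interior K)"
    unfolding set_diff_def by blast
  also have "\<dots> \<longleftrightarrow> (\<forall>u\<in>U. \<not> cone_less K (Fin y) u)"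
    using assms * by (intro ball_cong refl) blast
  finally show ?thesis by (simp add: strict_lower_def)
qed

lemma strict_lower_add_WSup:
  assumes "strict_lower M \<noteq> {}" "strict_lower N \<noteq> {}"
  shows "strict_lower (WSup K M + WSup K N) = strict_lower M + strict_lower N"
  using strict_lower_add[of "WSup K M" "WSup K N"] Minf_notin_WSup assms
  by (auto simp: strict_lower_WSup)

text \<open>
  The finiteness clause says that the strict lower set is not the whole space, which already
  follows when some \<open>y\<close> is outside it; the two clauses therefore merge into one. The same
  happens for sums of two and three weak suprema below.
\<close>

lemma WSup_avoids_iff:
  assumes "strict_lower M \<noteq> {}"
  shows "WSup K M \<subseteq> range Fin \<and> set_diff {Fin y} (WSup K M) \<inter> Fin ` uminus ` interior K = {}
     \<longleftrightarrow> y \<notin> strict_lower M"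
  using WSup_finite_iff[OF assms] difference_avoids_iff[of "WSup K M" y] strict_lower_WSup[of M]
  by auto

lemma WSup_sum_avoids_iff:
  assumes "strict_lower M \<noteq> {}" "strict_lower N \<noteq> {}"
  shows "WS_sum K (WSup K M) (WSup K N) \<subseteq> range Fin \<and>
      set_diff (set_diff {Fin y} (WSup K M)) (WSup K N) \<inter> Fin ` uminus ` interior K = {}
     \<longleftrightarrow> y \<notin> strict_lower M + strict_lower N"
    (is "?fin \<and> ?avoid \<longleftrightarrow> _")
proof -
  let ?U = "WSup K M" and ?V = "WSup K N"
  have low: "strict_lower (?U + ?V) = strict_lower M + strict_lower N"
    using strict_lower_add_WSup assms .
  have fin: "?fin \<longleftrightarrow> strict_lower M + strict_lower N \<noteq> UNIV"
    unfolding WS_sum_def using WSup_finite_iff[of "?U + ?V"] low set_plus_nonempty[OF assms] by simp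
  have "?avoid \<longleftrightarrow> y \<notin> strict_lower M + strict_lower N" if ?fin
  proof -
    have UV: "?U \<subseteq> range Fin" "?V \<subseteq> range Fin"
      using fin that set_plus_UNIV[OF assms] WSup_finite_iff assms by auto
    then show ?thesis
      using set_diff_set_diff[of "{Fin y}" ?U ?V] difference_avoids_iff[OF set_plus_subset_Fin[OF UV], of y] low
      by auto
  qed
  then show ?thesis using fin by blast
qed

lemma WSup_sum3_avoids_iff:
  assumes "strict_lower M \<noteq> {}" "strict_lower N \<noteq> {}" "strict_lower P \<noteq> {}"
  shows "WS_sum K (WS_sum K (WSup K M) (WSup K N)) (WSup K P) \<subseteq> range Fin \<and>
      set_diff (set_diff (set_diff {Fin y} (WSup K M)) (WSup K N)) (WSup K P)
        \<inter> Fin ` uminus ` interior K = {}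
     \<longleftrightarrow> y \<notin> strict_lower M + strict_lower N + strict_lower P"
    (is "?fin \<and> ?avoid \<longleftrightarrow> _")
proof -
  let ?U = "WSup K M" and ?V = "WSup K N" and ?W = "WSup K P"
  let ?A = "strict_lower M + strict_lower N"
  have ne: "?A \<noteq> {}" using set_plus_nonempty[OF assms(1,2)] .
  have low2: "strict_lower (?U + ?V) = ?A"
    using strict_lower_add_WSup assms(1,2) .
  have low3: "strict_lower (WS_sum K ?U ?V + ?W) = ?A + strict_lower P"
    unfolding WS_sum_def using strict_lower_add_WSup[of "?U + ?V" P] low2 ne assms(3) by simp
  have fin: "?fin \<longleftrightarrow> ?A + strict_lower P \<noteq> UNIV"
    unfolding WS_sum_def[of K "WS_sum K ?U ?V"]
    using WSup_finite_iff[of "WS_sum K ?U ?V + ?W"] low3 set_plus_nonempty[OF ne assms(3)] by simp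
  have "?avoid \<longleftrightarrow> y \<notin> ?A + strict_lower P" if ?fin
  proof -
    have UVW: "?U \<subseteq> range Fin" "?V \<subseteq> range Fin" "?W \<subseteq> range Fin"
      using fin that set_plus_UNIV[OF assms(1,2)] set_plus_UNIV[OF ne assms(3)] WSup_finite_iff assms by auto
    have UV: "?U + ?V \<subseteq> range Fin" using set_plus_subset_Fin UVW by blast
    have "strict_lower (?U + ?V + ?W) = ?A + strict_lower P"
      using strict_lower_add[of "?U + ?V" ?W] UV UVW(3) low2 strict_lower_WSup[of P] by auto
    moreover have "set_diff (set_diff (set_diff {Fin y} ?U) ?V) ?W = set_diff {Fin y} (?U + ?V + ?W)"
      using set_diff_set_diff[of "{Fin y}" ?U ?V] set_diff_set_diff[of "{Fin y}" "?U + ?V" ?W] UV UVW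
      by simp
    ultimately show ?thesis using difference_avoids_iff[OF set_plus_subset_Fin[OF UV UVW(3)], of y] by simp
  qed
  then show ?thesis using fin by blast
qed

section \<open>Conjugates\<close>

definition conj_lower :: "('x \<Rightarrow> 'y extended) \<Rightarrow> ('x \<Rightarrow> 'y) \<Rightarrow> 'y set" where
  "conj_lower H L = strict_lower (range (\<lambda>x. Fin (L x) - H x))"

lemma mem_conj_lower:
  assumes "Minf \<notin> range H"
  shows "y \<in> conj_lower H L \<longleftrightarrow> (\<exists>x h. H x = Fin h \<and> L x - h - y \<in> interior K)"
proof -
  have "cone_less K (Fin y) (Fin (L x) - H x) \<longleftrightarrow> (\<exists>h. H x = Fin h \<and> L x - h - y \<in> interior K)" for x
    using assms rangeI[of H x] by (cases "H x") (simp_all add: cone_less_Fin del: cone_less.simps(1))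
  then show ?thesis by (auto simp: conj_lower_def strict_lower_def)
qed

lemma conj_lower_nonempty:
  assumes "Minf \<notin> range H" "H x = Fin h"
  shows "conj_lower H L \<noteq> {}"
proof -
  obtain k where "k \<in> interior K" using solid_K by blast
  then have "L x - h - k \<in> conj_lower H L"
    unfolding mem_conj_lower[OF assms(1)] using assms(2) by (intro exI[of _ x] exI[of _ h]) simp
  then show ?thesis by blast
qed

text \<open>
  Weak duality for a sum: evaluating both summands at one and the same point is a special
  choice among the independent points that the right-hand side allows.
\<close>

lemma conj_lower_add:
  assumes "Minf \<notin> range H1" "Minf \<notin> range H2" "Minf \<notin> range (\<lambda>x. H1 x + H2 x)"
    and "y \<in> conj_lower (\<lambda>x. H1 x + H2 x) (\<lambda>x. L1 x + L2 x)"
  shows "y \<in> conj_lower H1 L1 + conj_lower H2 L2"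
proof -
  obtain x h where x: "H1 x + H2 x = Fin h" "(L1 x + L2 x) - h - y \<in> interior K"
    using assms(4) unfolding mem_conj_lower[OF assms(3)] by blast
  then obtain h1 h2 where h: "H1 x = Fin h1" "H2 x = Fin h2" "h = h1 + h2"
    by (cases "H1 x"; cases "H2 x") auto
  define p where "p = (1/2) *\<^sub>R ((L1 x + L2 x) - h - y)"
  have p: "p \<in> interior K" unfolding p_def using x(2) by (intro cone_interior_scale cone_K) auto
  have "p + p = (L1 x + L2 x) - h - y" unfolding p_def by (simp flip: scaleR_add_left)
  then have y: "y = (L1 x - h1 - p) + (L2 x - h2 - p)" unfolding h(3) by (simp add: algebra_simps)
  have "L1 x - h1 - p \<in> conj_lower H1 L1"
    unfolding mem_conj_lower[OF assms(1)] using h p by (intro exI[of _ x] exI[of _ h1]) simp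
  moreover have "L2 x - h2 - p \<in> conj_lower H2 L2"
    unfolding mem_conj_lower[OF assms(2)] using h p by (intro exI[of _ x] exI[of _ h2]) simp
  ultimately show ?thesis unfolding y by (rule set_plus_intro)
qed

lemma conj_map_avoids_iff:
  assumes "conj_lower H L \<noteq> {}"
  shows "conj_map K H L \<subseteq> range Fin \<and> set_diff {Fin y} (conj_map K H L) \<inter> Fin ` uminus ` interior K = {}
     \<longleftrightarrow> y \<notin> conj_lower H L"
  using WSup_avoids_iff assms unfolding conj_map_def conj_lower_def by simp

lemma conj_map_sum_avoids_iff:
  assumes "conj_lower H1 L1 \<noteq> {}" "conj_lower H2 L2 \<noteq> {}"
  shows "WS_sum K (conj_map K H1 L1) (conj_map K H2 L2) \<subseteq> range Fin \<and>
      set_diff (set_diff {Fin y} (conj_map K H1 L1)) (conj_map K H2 L2) \<inter> Fin ` uminus ` interior K = {}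
     \<longleftrightarrow> y \<notin> conj_lower H1 L1 + conj_lower H2 L2"
  using WSup_sum_avoids_iff assms unfolding conj_map_def conj_lower_def by simp

lemma conj_map_sum3_avoids_iff:
  assumes "conj_lower H1 L1 \<noteq> {}" "conj_lower H2 L2 \<noteq> {}" "conj_lower H3 L3 \<noteq> {}"
  shows "WS_sum K (WS_sum K (conj_map K H1 L1) (conj_map K H2 L2)) (conj_map K H3 L3) \<subseteq> range Fin \<and>
      set_diff (set_diff (set_diff {Fin y} (conj_map K H1 L1)) (conj_map K H2 L2)) (conj_map K H3 L3)
        \<inter> Fin ` uminus ` interior K = {}
     \<longleftrightarrow> y \<notin> conj_lower H1 L1 + conj_lower H2 L2 + conj_lower H3 L3"
  using WSup_sum3_avoids_iff assms unfolding conj_map_def conj_lower_def by simp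

end

section \<open>Vector Lagrange multipliers\<close>

lemma linear_partial_application:
  assumes "linear h"
  shows "linear (\<lambda>p. h (p, 0))" "linear (\<lambda>q. h (0, q))"
proof -
  have "linear (\<lambda>p. (p, 0))" "linear (\<lambda>q. (0, q))"
    by (auto intro!: linearI)
  from this[THEN linear_compose, OF assms]
  show "linear (\<lambda>p. h (p, 0))" "linear (\<lambda>q. h (0, q))" by (simp_all add: o_def)
qed

text \<open>
  Along a half-line that stays in \<open>D\<close>, a negative slope would drive \<open>f\<close> below zero.
\<close>

lemma nonneg_on_recession_direction:
  fixes f :: "'a::real_vector \<Rightarrow> real"
  assumes "linear f" "d \<in> D" "\<And>n. n > 0 \<Longrightarrow> d + n *\<^sub>R v \<in> D" "\<And>x. x \<in> D \<Longrightarrow> 0 \<le> f x"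
  shows "0 \<le> f v"
proof (rule ccontr)
  assume "\<not> 0 \<le> f v"
  then have v: "f v < 0" by simp
  define n where "n = (f d + 1) / - f v"
  have "n > 0" using assms(4)[OF assms(2)] v unfolding n_def by (intro divide_pos_pos) auto
  then have "0 \<le> f (d + n *\<^sub>R v)" using assms(3,4) by blast
  also have "\<dots> = f d + n * f v" using assms(1) by (simp add: linear_add linear_scale)
  also have "\<dots> = - 1" using v unfolding n_def by (simp add: field_simps)
  finally show False by simp
qed

text \<open>
  Adding \<open>s0\<close> and a large interior vector of \<open>K\<close> to the Slater point \<open>(c, - s0)\<close> produces
  a core point of \<open>D\<close> of the form \<open>(b, 0)\<close> with \<open>b\<close> in the interior of \<open>K\<close>. Separating at this point normalizes the first
  multiplier by \<open>f b = 1\<close>; without the Slater point it could vanish. Each multiplier is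
  nonnegative on a cone with nonempty interior, hence continuous.
\<close>

lemma Slater_multipliers:
  fixes K :: "'y::locally_convex_t2 set" and S :: "'z::locally_convex_t2 set"
    and D :: "('y \<times> 'z) set"
  assumes K: "solid_cone K" and S: "convex S" "cone S"
    and "convex D"
    and up: "\<And>p q k s. \<lbrakk>(p, q) \<in> D; k \<in> K; s \<in> S\<rbrakk> \<Longrightarrow> (p + k, q + s) \<in> D"
    and Slater: "(c, - s0) \<in> D" "s0 \<in> interior S"
    and avoid: "\<And>p. (p, 0) \<in> D \<Longrightarrow> - p \<notin> interior K"
  shows "\<exists>f g b. linear f \<and> continuous_on UNIV f \<and> linear g \<and> continuous_on UNIV g
    \<and> b \<in> interior K \<and> f b = (1::real) \<and> (\<forall>k\<in>K. 0 \<le> f k) \<and> (\<forall>s\<in>S. (0::real) \<le> g s)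
    \<and> (\<forall>(p, q)\<in>D. 0 \<le> f p + g q)"
proof -
  interpret solid_cone K by (rule K)
  obtain k where k: "k \<in> interior K" using solid_K by blast
  have zero: "0 \<in> K" "0 \<in> S"
    using k Slater(2) cone_K S(2) interior_subset cone_contains_0 by blast+
  obtain n where n: "n > 0" "n *\<^sub>R k + c \<in> interior K"
    using cone_interior_absorbs[OF cone_K k] by blast
  define a where "a = n *\<^sub>R k"
  define b where "b = c + a"
  have a: "a \<in> interior K" unfolding a_def using cone_interior_scale[OF cone_K k n(1)] .
  have b: "b \<in> interior K" using n(2) by (simp add: b_def a_def add.commute)
  have "\<exists>h::'y \<times> 'z \<Rightarrow> real. linear h \<and> h (b, 0) = 1 \<and> (\<forall>x\<in>D. 0 \<le> h x)"
  proof (rule separation_at_core_point[OF \<open>convex D\<close>])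
    show "(b, 0::'z) \<noteq> 0" using b zero_notin_interior by (auto simp: zero_prod_def)
    fix v :: "'y \<times> 'z"
    obtain v1 v2 where v: "v = (v1, v2)" by (cases v)
    obtain d1 where d1: "d1 > 0" "\<And>t. \<lbrakk>0 < t; t \<le> d1\<rbrakk> \<Longrightarrow> a + t *\<^sub>R v1 \<in> interior K"
      using open_contains_small_steps[OF open_interior a] by blast
    obtain d2 where d2: "d2 > 0" "\<And>t. \<lbrakk>0 < t; t \<le> d2\<rbrakk> \<Longrightarrow> s0 + t *\<^sub>R v2 \<in> interior S"
      using open_contains_small_steps[OF open_interior Slater(2)] by blast
    define d where "d = min d1 d2"
    have d: "d > 0" "d \<le> d1" "d \<le> d2" using d1 d2 by (auto simp: d_def)
    have "a + d *\<^sub>R v1 \<in> K" "s0 + d *\<^sub>R v2 \<in> S"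
      using d1(2)[OF d(1,2)] d2(2)[OF d(1,3)] interior_subset by blast+
    then have "(c + (a + d *\<^sub>R v1), - s0 + (s0 + d *\<^sub>R v2)) \<in> D"
      using up[OF Slater(1)] by blast
    moreover have "(c + (a + d *\<^sub>R v1), - s0 + (s0 + d *\<^sub>R v2)) = (b, 0) + d *\<^sub>R v"
      by (simp add: v b_def)
    ultimately show "\<exists>s>0. (b, 0) + s *\<^sub>R v \<in> D" using d(1) by auto
  next
    fix t :: real assume "t < 0"
    then have "- (t *\<^sub>R b) \<in> interior K" using cone_interior_scale[OF cone_K b, of "- t"] by simp
    then show "t *\<^sub>R (b, 0) \<notin> D" using avoid by auto
  qed
  then obtain h :: "'y \<times> 'z \<Rightarrow> real" where h: "linear h" "h (b, 0) = 1" "\<And>x. x \<in> D \<Longrightarrow> 0 \<le> h x"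
    by blast
  define f where "f p = h (p, 0)" for p
  define g where "g q = h (0, q)" for q
  have lin: "linear f" "linear g"
    unfolding f_def g_def using linear_partial_application[OF h(1)] by auto
  have split: "h (p, q) = f p + g q" for p q
    unfolding f_def g_def by (simp flip: linear_add[OF h(1)])
  have fK: "0 \<le> f p" if "p \<in> K" for p
    unfolding f_def
  proof (rule nonneg_on_recession_direction[OF h(1) Slater(1) _ h(3)])
    fix n :: real assume "n > 0"
    then have "(c + n *\<^sub>R p, - s0 + 0) \<in> D" using that zero cone_K by (intro up Slater mem_cone) auto
    then show "(c, - s0) + n *\<^sub>R (p, 0) \<in> D" by simp
  qed
  have gS: "0 \<le> g q" if "q \<in> S" for q
    unfolding g_def
  proof (rule nonneg_on_recession_direction[OF h(1) Slater(1) _ h(3)])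
    fix n :: real assume "n > 0"
    then have "(c + 0, - s0 + n *\<^sub>R q) \<in> D" using that zero S by (intro up Slater mem_cone) auto
    then show "(c, - s0) + n *\<^sub>R (0, q) \<in> D" by simp
  qed
  have "continuous_on UNIV f" "continuous_on UNIV g"
    using linear_continuous_if_bounded_below[OF lin(1) open_interior solid_K, of 0]
      linear_continuous_if_bounded_below[OF lin(2) open_interior[of S], of 0]
      Slater(2) fK gS interior_subset by blast+
  moreover have "f b = 1" using h(2) by (simp add: f_def)
  moreover have "\<forall>(p, q)\<in>D. 0 \<le> f p + g q" using h(3) split by fastforce
  ultimately show ?thesis using lin b fK gS by blast
qed

lemma cone_le_Fin_iff:
  "cone_le K w (Fin p) \<longleftrightarrow> w = Minf \<or> (\<exists>a. w = Fin a \<and> p - a \<in> K)"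
proof (cases w)
  case (Fin a)
  have "a - p \<in> uminus ` K \<longleftrightarrow> - (a - p) \<in> K" by (metis image_iff minus_minus)
  then show ?thesis using Fin by simp
qed auto

lemma cone_convexD:
  assumes "cone_convex K H" "cone_le K (H x) (Fin p)" "cone_le K (H x') (Fin p')"
    and "0 \<le> u" "0 \<le> v" "u + v = 1"
  shows "cone_le K (H (u *\<^sub>R x + v *\<^sub>R x')) (Fin (u *\<^sub>R p + v *\<^sub>R p'))"
  using convexD[of "{(x, y). cone_le K (H x) (Fin y)}" "(x, p)" "(x', p')" u v] assms
  by (auto simp: cone_convex_def)

text \<open>
  \<open>Slater_multipliers\<close> applied to the pairs that dominate \<open>(F x - L x + y, G x)\<close> for some
  \<open>x\<close> in \<open>C\<close>; passing from values to dominating pairs is what makes the set convex.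
\<close>

lemma (in solid_cone) Lagrange_multipliers:
  fixes S :: "'z::locally_convex_t2 set" and F :: "'x::real_vector \<Rightarrow> 'y extended"
    and G :: "'x \<Rightarrow> 'z extended"
  assumes S: "convex S" "cone S"
    and F: "cone_convex K F" "Minf \<notin> range F"
    and G: "cone_convex S G" "Minf \<notin> range G"
    and "convex C" "linear L"
    and Slater: "x1 \<in> C" "F x1 = Fin a1" "G x1 = Fin (- s1)" "s1 \<in> interior S"
    and no_descent: "\<forall>x\<in>C. \<forall>a. \<forall>s\<in>S. F x = Fin a \<longrightarrow> G x = Fin (- s) \<longrightarrow> - (a - L x + y) \<notin> interior K"
  shows "\<exists>f g b. linear f \<and> continuous_on UNIV f \<and> linear g \<and> continuous_on UNIV g
    \<and> b \<in> interior K \<and> f b = (1::real) \<and> (\<forall>k\<in>K. 0 \<le> f k) \<and> (\<forall>s\<in>S. (0::real) \<le> g s)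
    \<and> (\<forall>x\<in>C. \<forall>a q. F x = Fin a \<longrightarrow> G x = Fin q \<longrightarrow> 0 \<le> f (a - L x + y) + g q)"
proof -
  define D where "D = {(p, q). \<exists>x\<in>C. cone_le K (F x) (Fin (p + L x - y)) \<and> cone_le S (G x) (Fin q)}"
  have D: "(p, q) \<in> D \<longleftrightarrow> (\<exists>x\<in>C. \<exists>a z. F x = Fin a \<and> G x = Fin z \<and>
      p - (a - L x + y) \<in> K \<and> q - z \<in> S)" for p q
  proof -
    have "F x \<noteq> Minf" "G x \<noteq> Minf" for x using F(2) G(2) by (metis rangeI)+
    then show ?thesis
      unfolding D_def by (auto simp: cone_le_Fin_iff algebra_simps simp del: cone_le.simps)
  qed
  have zero: "0 \<in> K" "0 \<in> S"
    using solid_K cone_K Slater(4) S(2) interior_subset cone_contains_0 by blast+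
  have in_D: "(a - L x + y, q) \<in> D" if "x \<in> C" "F x = Fin a" "G x = Fin q" for x a q
    unfolding D using that zero by (intro bexI[of _ x] exI[of _ a] exI[of _ q]) auto
  have "\<exists>f g b. linear f \<and> continuous_on UNIV f \<and> linear g \<and> continuous_on UNIV g
    \<and> b \<in> interior K \<and> f b = (1::real) \<and> (\<forall>k\<in>K. 0 \<le> f k) \<and> (\<forall>s\<in>S. (0::real) \<le> g s)
    \<and> (\<forall>(p, q)\<in>D. 0 \<le> f p + g q)"
  proof (rule Slater_multipliers[OF solid_cone_axioms S])
    show "convex D"
    proof (rule convexI)
      fix d d' and u v :: real assume dd: "d \<in> D" "d' \<in> D" and uv: "0 \<le> u" "0 \<le> v" "u + v = 1"
      obtain p q x where 1: "d = (p, q)" "x \<in> C" "cone_le K (F x) (Fin (p + L x - y))" "cone_le S (G x) (Fin q)"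
        using dd(1) by (auto simp: D_def)
      obtain p' q' x' where 2: "d' = (p', q')" "x' \<in> C" "cone_le K (F x') (Fin (p' + L x' - y))" "cone_le S (G x') (Fin q')"
        using dd(2) by (auto simp: D_def)
      let ?x = "u *\<^sub>R x + v *\<^sub>R x'"
      have "u *\<^sub>R y + v *\<^sub>R y = y" using uv(3) by (metis scaleR_add_left scaleR_one)
      then have eq: "u *\<^sub>R (p + L x - y) + v *\<^sub>R (p' + L x' - y) = (u *\<^sub>R p + v *\<^sub>R p') + L ?x - y"
        by (simp add: linear_add[OF \<open>linear L\<close>] linear_scale[OF \<open>linear L\<close>] algebra_simps)
      have "cone_le K (F ?x) (Fin ((u *\<^sub>R p + v *\<^sub>R p') + L ?x - y))"
        using cone_convexD[OF F(1) 1(3) 2(3) uv] unfolding eq .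
      moreover have "cone_le S (G ?x) (Fin (u *\<^sub>R q + v *\<^sub>R q'))"
        using cone_convexD[OF G(1) 1(4) 2(4) uv] .
      moreover have "?x \<in> C" using convexD[OF \<open>convex C\<close> 1(2) 2(2) uv] .
      ultimately show "u *\<^sub>R d + v *\<^sub>R d' \<in> D" unfolding D_def 1(1) 2(1) by auto
    qed
  next
    fix p q k s assume "(p, q) \<in> D" "k \<in> K" "s \<in> S"
    then obtain x a z where "x \<in> C" "F x = Fin a" "G x = Fin z" "p - (a - L x + y) \<in> K" "q - z \<in> S"
      unfolding D by blast
    moreover have "(p + k) - (a - L x + y) \<in> K" "(q + s) - z \<in> S"
      using convex_cone_addD[OF convex_K cone_K calculation(4) \<open>k \<in> K\<close>]
        convex_cone_addD[OF S calculation(5) \<open>s \<in> S\<close>] by (simp_all add: algebra_simps)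
    ultimately show "(p + k, q + s) \<in> D" unfolding D by blast
  next
    show "(a1 - L x1 + y, - s1) \<in> D" using in_D Slater by blast
    show "s1 \<in> interior S" by (rule Slater)
  next
    fix p assume "(p, 0) \<in> D"
    then obtain x a z where x: "x \<in> C" "F x = Fin a" "G x = Fin z" "p - (a - L x + y) \<in> K" "- z \<in> S"
      unfolding D by auto
    show "- p \<notin> interior K"
    proof
      assume "- p \<in> interior K"
      then have "- p + (p - (a - L x + y)) \<in> interior K"
        using cone_interior_add[OF convex_K cone_K] x(4) by blast
      moreover have "- (a - L x + y) \<notin> interior K"
        using no_descent[rule_format, OF x(1,5,2)] x(3) by simp
      ultimately show False by simp
    qed
  qed
  then obtain f g b where fgb: "linear f" "continuous_on UNIV f" "linear g" "continuous_on UNIV g"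
    "b \<in> interior K" "f b = (1::real)" "\<forall>k\<in>K. 0 \<le> f k" "\<forall>s\<in>S. (0::real) \<le> g s"
    and fD: "\<forall>(p, q)\<in>D. 0 \<le> f p + g q" by blast
  have "\<forall>x\<in>C. \<forall>a q. F x = Fin a \<longrightarrow> G x = Fin q \<longrightarrow> 0 \<le> f (a - L x + y) + g q"
    using fD in_D by fast
  then show ?thesis using fgb by blast
qed

lemma rank_one_cont_lin:
  fixes f :: "'x::locally_convex_t2 \<Rightarrow> real" and b :: "'y::locally_convex_t2"
  assumes "linear f" "continuous_on UNIV f"
  shows "(\<lambda>x. f x *\<^sub>R b) \<in> cont_lin"
  unfolding cont_lin_def
proof (intro CollectI conjI)
  show "linear (\<lambda>x. f x *\<^sub>R b)"
    by (auto intro!: linearI simp: linear_add[OF assms(1)] linear_scale[OF assms(1)] algebra_simps)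
  show "continuous_on UNIV (\<lambda>x. f x *\<^sub>R b)"
    by (intro continuous_on_scaleR_tvs assms continuous_on_const)
qed

lemma rank_one_pos_cont_lin:
  fixes g :: "'z::locally_convex_t2 \<Rightarrow> real" and K :: "'y::locally_convex_t2 set"
  assumes "linear g" "continuous_on UNIV g" "\<forall>s\<in>S. 0 \<le> g s" "cone K" "b \<in> K"
  shows "(\<lambda>z. g z *\<^sub>R b) \<in> pos_cont_lin S K"
  unfolding pos_cont_lin_def using assms mem_cone by (auto intro!: rank_one_cont_lin)

section \<open>Splitting convex inequalities\<close>

text \<open>
  \<open>E\<close> and \<open>H\<close> play the role of epigraphs of two convex functions with nonnegative sum. The
  functional \<open>\<phi>\<close> comes from separating, in \<open>X \<times> \<real>\<close>, the set of all \<open>(x - x', t)\<close>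
  with \<open>t\<close> at least the sum of a value at \<open>x\<close> and a value at \<open>x'\<close> from the downward
  vertical ray at the origin. Letting \<open>x\<close> and \<open>x'\<close> vary independently is what makes the
  inequality split. The neighbourhood \<open>U\<close>, on which the first function is bounded above, provides
  the core point and the continuity of \<open>\<phi>\<close>.
\<close>

lemma convex_sandwich:
  fixes E H :: "('x::real_tvs \<times> real) set"
  assumes "convex E" "convex H"
    and sum: "\<And>x r s. \<lbrakk>(x, r) \<in> E; (x, s) \<in> H\<rbrakk> \<Longrightarrow> 0 \<le> r + s"
    and U: "open U" "x0 \<in> U" "\<And>x. x \<in> U \<Longrightarrow> \<exists>r\<le>m. (x, r) \<in> E"
    and x0: "(x0, s0) \<in> H"
  shows "\<exists>\<phi> c. linear \<phi> \<and> continuous_on UNIV \<phi> \<and>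
    (\<forall>(x, r)\<in>E. c \<le> r + \<phi> x) \<and> (\<forall>(x, s)\<in>H. 0 \<le> s - \<phi> x + c)"
proof -
  define D where "D = {(x - x', t) | x x' t. \<exists>r s. (x, r) \<in> E \<and> (x', s) \<in> H \<and> r + s \<le> t}"
  have D: "(x - x', t) \<in> D" if "(x, r) \<in> E" "(x', s) \<in> H" "r + s \<le> t" for x x' r s t
    using that unfolding D_def by blast
  have "convex D"
  proof (rule convexI)
    fix d d' and u v :: real assume dd: "d \<in> D" "d' \<in> D" and uv: "0 \<le> u" "0 \<le> v" "u + v = 1"
    obtain x x' t r s where 1: "d = (x - x', t)" "(x, r) \<in> E" "(x', s) \<in> H" "r + s \<le> t"
      using dd(1) unfolding D_def by blast
    obtain y y' t' r' s' where 2: "d' = (y - y', t')" "(y, r') \<in> E" "(y', s') \<in> H" "r' + s' \<le> t'"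
      using dd(2) unfolding D_def by blast
    have "u *\<^sub>R (x, r) + v *\<^sub>R (y, r') \<in> E" "u *\<^sub>R (x', s) + v *\<^sub>R (y', s') \<in> H"
      using assms(1,2) 1 2 uv by (auto intro!: convexD simp del: scaleR_Pair add_Pair)
    then have m: "(u *\<^sub>R x + v *\<^sub>R y, u * r + v * r') \<in> E" "(u *\<^sub>R x' + v *\<^sub>R y', u * s + v * s') \<in> H"
      by simp_all
    have "u * (r + s) \<le> u * t" "v * (r' + s') \<le> v * t'" using 1 2 uv by (auto intro: mult_left_mono)
    then have "(u * r + v * r') + (u * s + v * s') \<le> u * t + v * t'" by (simp add: algebra_simps)
    from D[OF m this] show "u *\<^sub>R d + v *\<^sub>R d' \<in> D" unfolding 1(1) 2(1) by (simp add: algebra_simps)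
  qed
  \<comment> \<open>The additional 1 is the slack that absorbs small vertical perturbations at the core point.\<close>
  define M where "M = m + s0 + 1"
  have "M > 0"
    using U(3)[OF U(2)] sum x0 unfolding M_def by fastforce
  have "\<exists>h::'x \<times> real \<Rightarrow> real. linear h \<and> h (0, M) = 1 \<and> (\<forall>x\<in>D. 0 \<le> h x)"
  proof (rule separation_at_core_point[OF \<open>convex D\<close>])
    show "(0::'x, M) \<noteq> 0" using \<open>M > 0\<close> by (simp add: zero_prod_def)
    fix v :: "'x \<times> real"
    obtain v1 v2 where v: "v = (v1, v2)" by (cases v)
    obtain d1 where d1: "d1 > 0" "\<And>t. \<lbrakk>0 < t; t \<le> d1\<rbrakk> \<Longrightarrow> x0 + t *\<^sub>R v1 \<in> U"
      using open_contains_small_steps[OF U(1,2)] by blast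
    define d where "d = min d1 (1 / (\<bar>v2\<bar> + 1))"
    have d: "d > 0" "d \<le> d1" "d \<le> 1 / (\<bar>v2\<bar> + 1)"
      using d1(1) by (auto simp: d_def)
    obtain r where r: "r \<le> m" "(x0 + d *\<^sub>R v1, r) \<in> E" using U(3) d1(2)[OF d(1,2)] by blast
    have "d * (- v2) \<le> d * (\<bar>v2\<bar> + 1)" using d(1) by (intro mult_left_mono) auto
    also have "\<dots> \<le> 1" using d(3) by (simp add: field_simps)
    finally have "r + s0 \<le> M + d * v2" using r(1) by (simp add: M_def)
    from D[OF r(2) x0 this] have "(0, M) + d *\<^sub>R v \<in> D" by (simp add: v)
    then show "\<exists>s>0. (0, M) + s *\<^sub>R v \<in> D" using d(1) by blast
  next
    fix t :: real assume "t < 0"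
    show "t *\<^sub>R (0, M) \<notin> D"
    proof
      assume "t *\<^sub>R (0, M) \<in> D"
      then obtain x r s where "(x, r) \<in> E" "(x, s) \<in> H" "r + s \<le> t * M"
        unfolding D_def by auto
      then have "0 \<le> t * M" using sum by fastforce
      then show False using \<open>t < 0\<close> \<open>M > 0\<close> by (simp add: zero_le_mult_iff)
    qed
  qed
  then obtain h :: "'x \<times> real \<Rightarrow> real" where h: "linear h" "h (0, M) = 1" "\<And>x. x \<in> D \<Longrightarrow> 0 \<le> h x"
    by blast
  define \<phi> where "\<phi> x = M * h (x, 0)" for x
  have lin: "linear \<phi>"
    unfolding \<phi>_def
    using linear_compose_scale_right[OF linear_partial_application(1)[OF h(1)], of M] by simp
  have scaled: "M * h (x, t) = \<phi> x + t" for x t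
  proof -
    have "h (x, t) = h ((x, 0) + (t / M) *\<^sub>R (0, M))" using \<open>M > 0\<close> by simp
    also have "\<dots> = h (x, 0) + t / M"
      by (simp only: linear_add[OF h(1)] linear_scale[OF h(1)] h(2) real_scaleR_def mult_1_right)
    finally have "M * h (x, t) = M * (h (x, 0) + t / M)" by (rule arg_cong)
    also have "\<dots> = \<phi> x + t" using \<open>M > 0\<close> by (simp add: \<phi>_def distrib_left)
    finally show ?thesis .
  qed
  have nonneg: "0 \<le> \<phi> x + t" if "(x, t) \<in> D" for x t
    using h(3)[OF that] \<open>M > 0\<close> by (simp flip: scaled)
  have both: "0 \<le> (r + \<phi> x) + (s - \<phi> x')" if "(x, r) \<in> E" "(x', s) \<in> H" for x r x' s
    using nonneg[OF D[OF that order_refl]] linear_diff[OF lin] by simp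
  have "continuous_on UNIV \<phi>"
  proof (rule linear_continuous_if_bounded_below[OF lin U(1)])
    show "U \<noteq> {}" using U(2) by blast
    fix x assume "x \<in> U"
    then obtain r where "r \<le> m" "(x, r) \<in> E" using U(3) by blast
    then show "- m - s0 + \<phi> x0 \<le> \<phi> x" using both[of x r x0 s0] x0 by simp
  qed
  define c where "c = Inf ((\<lambda>(x, r). r + \<phi> x) ` E)"
  have E: "(\<lambda>(x, r). r + \<phi> x) ` E \<noteq> {}" using U(2,3) by blast
  have low: "- (s - \<phi> x') \<le> w" if "(x', s) \<in> H" "w \<in> (\<lambda>(x, r). r + \<phi> x) ` E" for x' s w
    using both that by force
  have "bdd_below ((\<lambda>(x, r). r + \<phi> x) ` E)" using low[OF x0] by (rule bdd_belowI)
  then have "c \<le> r + \<phi> x" if "(x, r) \<in> E" for x r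
    unfolding c_def using that by (intro cInf_lower) force+
  moreover have "0 \<le> s - \<phi> x' + c" if "(x', s) \<in> H" for x' s
    using cInf_greatest[OF E low[OF that]] unfolding c_def by simp
  ultimately show ?thesis using lin \<open>continuous_on UNIV \<phi>\<close> by blast
qed

text \<open>
  The epigraph of the composition of \<open>f\<close> and \<open>H\<close>, as a set: this avoids assigning a real
  value to the composition where \<open>H\<close> is infinite.
\<close>

definition scalar_epigraph :: "('x \<Rightarrow> 'y extended) \<Rightarrow> ('y \<Rightarrow> real) \<Rightarrow> ('x \<times> real) set" where
  "scalar_epigraph H f = {(x, r). \<exists>a. H x = Fin a \<and> f a \<le> r}"

lemma convex_scalar_epigraph:
  fixes K :: "'y::locally_convex_t2 set" and H :: "'x::real_vector \<Rightarrow> 'y extended"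
  assumes "cone_convex K H" "Minf \<notin> range H" "linear f" "\<And>k. k \<in> K \<Longrightarrow> 0 \<le> f k" "0 \<in> K"
  shows "convex (scalar_epigraph H f)"
proof (rule convexI)
  fix d d' and u v :: real
  assume dd: "d \<in> scalar_epigraph H f" "d' \<in> scalar_epigraph H f" and uv: "0 \<le> u" "0 \<le> v" "u + v = 1"
  obtain x r a where 1: "d = (x, r)" "H x = Fin a" "f a \<le> r"
    using dd(1) by (auto simp: scalar_epigraph_def)
  obtain x' r' a' where 2: "d' = (x', r')" "H x' = Fin a'" "f a' \<le> r'"
    using dd(2) by (auto simp: scalar_epigraph_def)
  have "cone_le K (H (u *\<^sub>R x + v *\<^sub>R x')) (Fin (u *\<^sub>R a + v *\<^sub>R a'))"
    using 1 2 \<open>0 \<in> K\<close> by (intro cone_convexD[OF assms(1) _ _ uv]) (auto simp: cone_le_Fin_iff simp del: cone_le.simps)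
  then obtain w where w: "H (u *\<^sub>R x + v *\<^sub>R x') = Fin w" "u *\<^sub>R a + v *\<^sub>R a' - w \<in> K"
    using assms(2) unfolding cone_le_Fin_iff by (metis rangeI)
  have "0 \<le> f (u *\<^sub>R a + v *\<^sub>R a' - w)" using w(2) assms(4) by blast
  then have "f w \<le> u * f a + v * f a'"
    by (simp add: linear_diff[OF assms(3)] linear_add[OF assms(3)] linear_scale[OF assms(3)])
  also have "\<dots> \<le> u * r + v * r'" using 1 2 uv by (intro add_mono mult_left_mono)
  finally show "u *\<^sub>R d + v *\<^sub>R d' \<in> scalar_epigraph H f" using w(1) 1(1) 2(1) by (simp add: scalar_epigraph_def)
qed

lemma convex_affine_perturbation:
  fixes E :: "('x::real_vector \<times> real) set"
  assumes "convex E" "convex C" "linear l"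
  shows "convex {(x, r). x \<in> C \<and> (x, r + l x + c) \<in> E}"
proof (rule convexI)
  fix d d' and u v :: real
  assume dd: "d \<in> {(x, r). x \<in> C \<and> (x, r + l x + c) \<in> E}" "d' \<in> {(x, r). x \<in> C \<and> (x, r + l x + c) \<in> E}"
    and uv: "0 \<le> u" "0 \<le> v" "u + v = 1"
  obtain x r where 1: "d = (x, r)" "x \<in> C" "(x, r + l x + c) \<in> E" using dd(1) by auto
  obtain x' r' where 2: "d' = (x', r')" "x' \<in> C" "(x', r' + l x' + c) \<in> E" using dd(2) by auto
  have "u *\<^sub>R (x, r + l x + c) + v *\<^sub>R (x', r' + l x' + c) \<in> E"
    using convexD[OF assms(1) 1(3) 2(3) uv] .
  moreover have "u * (r + l x + c) + v * (r' + l x' + c)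
      = (u * r + v * r') + l (u *\<^sub>R x + v *\<^sub>R x') + c"
  proof -
    have "u * c + v * c = c" using uv(3) by (metis distrib_right mult_1)
    then show ?thesis
      by (simp add: linear_add[OF assms(3)] linear_scale[OF assms(3)] algebra_simps)
  qed
  ultimately have "(u *\<^sub>R x + v *\<^sub>R x', (u * r + v * r') + l (u *\<^sub>R x + v *\<^sub>R x') + c) \<in> E" by simp
  then show "u *\<^sub>R d + v *\<^sub>R d' \<in> {(x, r). x \<in> C \<and> (x, r + l x + c) \<in> E}"
    using convexD[OF assms(2) 1(2) 2(2) uv] 1(1) 2(1) by simp
qed

lemma continuous_at_ext_scalar_bound:
  fixes H :: "'x::topological_space \<Rightarrow> 'y::topological_space extended" and f :: "'y \<Rightarrow> real"
  assumes "continuous_at_ext H x" "continuous_on UNIV f"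
  shows "\<exists>U m. open U \<and> x \<in> U \<and> (\<forall>u\<in>U. (u, m) \<in> scalar_epigraph H f)"
proof -
  obtain h where h: "H x = Fin h"
    "\<And>V. \<lbrakk>open V; h \<in> V\<rbrakk> \<Longrightarrow> \<exists>U. open U \<and> x \<in> U \<and> H ` U \<subseteq> Fin ` V"
    using assms(1) by (auto simp: continuous_at_ext_def)
  have "open (f -` {..<f h + 1})" using assms(2) by (intro open_vimage) auto
  then obtain U where "open U" "x \<in> U" "H ` U \<subseteq> Fin ` (f -` {..<f h + 1})" using h(2) by force
  then show ?thesis by (intro exI[of _ U] exI[of _ "f h + 1"]) (force simp: scalar_epigraph_def)
qed

text \<open>
  The sandwich theorem for the sum of a function with epigraph \<open>E\<close> and the function on
  \<open>C\<close> that is obtained from the one with epigraph \<open>E'\<close> by subtracting an affine term.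
\<close>

lemma split_off_function:
  fixes E E' :: "('x::real_tvs \<times> real) set"
  assumes "convex E" "convex E'" "convex C" "linear l"
    and nonneg: "\<And>x r s. \<lbrakk>(x, r) \<in> E; x \<in> C; (x, s) \<in> E'\<rbrakk> \<Longrightarrow> 0 \<le> r + (s - l x + k)"
    and U: "open U" "x0 \<in> U" "\<And>x. x \<in> U \<Longrightarrow> (x, m) \<in> E"
    and x0: "x0 \<in> C" "(x0, s0) \<in> E'"
  shows "\<exists>\<phi> c. linear \<phi> \<and> continuous_on UNIV \<phi> \<and> (\<forall>(x, r)\<in>E. c \<le> r + \<phi> x)
    \<and> (\<forall>x\<in>C. \<forall>s. (x, s) \<in> E' \<longrightarrow> 0 \<le> s - l x + k - \<phi> x + c)"
proof -
  let ?H = "{(x, s). x \<in> C \<and> (x, s + l x + - k) \<in> E'}"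
  have H: "(x, s - l x + k) \<in> ?H" if "x \<in> C" "(x, s) \<in> E'" for x s using that by simp
  have "\<exists>\<phi> c. linear \<phi> \<and> continuous_on UNIV \<phi> \<and>
      (\<forall>(x, r)\<in>E. c \<le> r + \<phi> x) \<and> (\<forall>(x, s)\<in>?H. 0 \<le> s - \<phi> x + c)"
  proof (rule convex_sandwich[OF \<open>convex E\<close> _ _ U(1,2) _ H[OF x0]])
    show "convex ?H" by (rule convex_affine_perturbation) fact+
    show "\<exists>r\<le>m. (u, r) \<in> E" if "u \<in> U" for u using U(3)[OF that] by blast
    show "0 \<le> r + s" if "(x, r) \<in> E" "(x, s) \<in> ?H" for x r s
      using that nonneg[of x r "s + l x + - k"] by simp
  qed
  then show ?thesis using H by blast
qed

text \<open>
  Here the second function of the sandwich is the indicator of \<open>C\<close>, so that the inequality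
  extends from \<open>C\<close> to the whole domain at the price of a functional \<open>\<psi>\<close> that is bounded above
  on \<open>C\<close>.
\<close>

lemma split_off_constraint:
  fixes E :: "('x::real_tvs \<times> real) set"
  assumes "convex E" "convex C" "linear l" "continuous_on UNIV l"
    and nonneg: "\<And>x s. \<lbrakk>x \<in> C; (x, s) \<in> E\<rbrakk> \<Longrightarrow> 0 \<le> s - l x + k"
    and U: "open U" "x0 \<in> U" "\<And>x. x \<in> U \<Longrightarrow> (x, m) \<in> E" and "x0 \<in> C"
  shows "\<exists>\<psi> d. linear \<psi> \<and> continuous_on UNIV \<psi> \<and> (\<forall>(x, s)\<in>E. d \<le> s - l x + k + \<psi> x)
    \<and> (\<forall>x\<in>C. \<psi> x \<le> d)"
proof -
  let ?E = "{(x, s). x \<in> UNIV \<and> (x, s + l x + - k) \<in> E}"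
  let ?U = "U \<inter> l -` {l x0 - 1<..}"
  have "\<exists>\<psi> d. linear \<psi> \<and> continuous_on UNIV \<psi> \<and>
      (\<forall>(x, r)\<in>?E. d \<le> r + \<psi> x) \<and> (\<forall>(x, s)\<in>C \<times> {0}. 0 \<le> s - \<psi> x + d)"
  proof (rule convex_sandwich)
    show "convex ?E" by (rule convex_affine_perturbation) (simp_all add: assms)
    show "convex (C \<times> {0::real})" using \<open>convex C\<close> by (intro convex_Times convex_singleton)
    show "0 \<le> r + s" if "(x, r) \<in> ?E" "(x, s) \<in> C \<times> {0}" for x r s
      using that nonneg[of x "r + l x + - k"] by simp
    show "open ?U" using U(1) assms(4) by (intro open_Int open_vimage) auto
    show "x0 \<in> ?U" using U(2) by simp
    show "\<exists>r\<le>m - l x0 + 1 + k. (u, r) \<in> ?E" if "u \<in> ?U" for u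
      using that U(3)[of u] by (intro exI[of _ "m - l u + k"]) auto
    show "(x0, 0) \<in> C \<times> {0}" using \<open>x0 \<in> C\<close> by simp
  qed
  then obtain \<psi> d where \<psi>: "linear \<psi>" "continuous_on UNIV \<psi>"
    and 1: "\<forall>(x, r)\<in>?E. d \<le> r + \<psi> x" and 2: "\<forall>(x, s)\<in>C \<times> {0::real}. 0 \<le> s - \<psi> x + d" by blast
  have "d \<le> s - l x + k + \<psi> x" if "(x, s) \<in> E" for x s
  proof -
    have "(x, s - l x + k) \<in> ?E" using that by simp
    then show ?thesis using 1 by blast
  qed
  then show ?thesis using \<psi> 2 by fastforce
qed

section \<open>The Farkas equivalences\<close>

theorem corollary5p2:
  fixes K :: "'y::locally_convex_t2 set" and S :: "'z::locally_convex_t2 set"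
    and F :: "'x::locally_convex_t2 \<Rightarrow> 'y extended" and G :: "'x \<Rightarrow> 'z extended"
    and C A :: "'x set" and C1 C2 C3 :: bool
    and \<alpha> \<beta>1 \<beta>2 \<beta>3 :: "('x \<Rightarrow> 'y) \<Rightarrow> 'y \<Rightarrow> bool"
  assumes "closed K" "convex K" "cone K" "K \<noteq> UNIV" "interior K \<noteq> {}"
    and "S \<noteq> {}" "closed S" "convex S" "cone S"
    and "proper_map_ext F" "cone_convex K F"
    and "proper_map_ext G" "cone_convex S G"
    and "C \<noteq> {}" "convex C"
    and A_def: "A = C \<inter> G -` Fin ` uminus ` S"
    and "A \<inter> edom F \<noteq> {}"
    and C1_def: "C1 \<longleftrightarrow> (\<exists>x1 \<in> C \<inter> edom F. G x1 \<in> Fin ` uminus ` interior S)"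
    and C2_def: "C2 \<longleftrightarrow> (\<exists>x2 \<in> C \<inter> edom G. continuous_at_ext F x2)"
    and C3_def: "C3 \<longleftrightarrow> (\<exists>x3 \<in> C. continuous_at_ext G x3)"
    and \<alpha>_def: "\<And>L y. \<alpha> L y \<longleftrightarrow>
      (\<forall>x. x \<in> C \<and> G x \<in> Fin ` uminus ` S \<longrightarrow>
           F x - Fin (L x) + Fin y \<notin> Fin ` uminus ` interior K)"
    and \<beta>1_def: "\<And>L y. \<beta>1 L y \<longleftrightarrow>
      (\<exists>T \<in> pos_cont_lin S K.
         let U = conj_map K (\<lambda>x. F x + indicator_map C x + comp_ext T G x) L in
         U \<subseteq> range Fin \<and>
         set_diff {Fin y} U \<inter> Fin ` uminus ` interior K = {})"
    and \<beta>2_def: "\<And>L y. \<beta>2 L y \<longleftrightarrow>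
      (\<exists>L' \<in> cont_lin. \<exists>T \<in> pos_cont_lin S K.
         let U = conj_map K F L';
             V = conj_map K (\<lambda>x. indicator_map C x + comp_ext T G x) (\<lambda>x. L x - L' x) in
         WS_sum K U V \<subseteq> range Fin \<and>
         set_diff (set_diff {Fin y} U) V \<inter> Fin ` uminus ` interior K = {})"
    and \<beta>3_def: "\<And>L y. \<beta>3 L y \<longleftrightarrow>
      (\<exists>L' \<in> cont_lin. \<exists>L'' \<in> cont_lin. \<exists>T \<in> pos_cont_lin S K.
         let U = conj_map K F L';
             V = conj_map K (indicator_map C) L'';
             W = conj_map K (comp_ext T G) (\<lambda>x. L x - L' x - L'' x) in
         WS_sum K (WS_sum K U V) W \<subseteq> range Fin \<and>
         set_diff (set_diff (set_diff {Fin y} U) V) W \<inter> Fin ` uminus ` interior K = {})"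
  shows "(C1 \<longrightarrow> (\<forall>L \<in> cont_lin. \<forall>y. \<alpha> L y \<longleftrightarrow> \<beta>1 L y)) \<and>
         (C1 \<and> C2 \<longrightarrow> (\<forall>L \<in> cont_lin. \<forall>y. \<alpha> L y \<longleftrightarrow> \<beta>2 L y)) \<and>
         (C1 \<and> C2 \<and> C3 \<longrightarrow> (\<forall>L \<in> cont_lin. \<forall>y. \<alpha> L y \<longleftrightarrow> \<beta>3 L y))"
proof -
  interpret solid_cone K using assms(2-5) by unfold_locales auto
  note S = \<open>convex S\<close> \<open>cone S\<close>
  have noMinf: "F x \<noteq> Minf" "G x \<noteq> Minf" for x
    using \<open>proper_map_ext F\<close> \<open>proper_map_ext G\<close> unfolding proper_map_ext_def by (metis rangeI)+
  then have FM: "Minf \<notin> range F" and GM: "Minf \<notin> range G" by (metis rangeE)+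
  have zero_K: "0 \<in> K" using solid_K cone_K interior_subset cone_contains_0 by blast
  have zero_S: "0 \<in> S" using \<open>S \<noteq> {}\<close> S cone_contains_0 by blast
  obtain x0 s0 where x0: "x0 \<in> C" "G x0 = Fin (- s0)" "s0 \<in> S" "F x0 \<noteq> Pinf"
    using \<open>A \<inter> edom F \<noteq> {}\<close> unfolding A_def edom_def by auto
  then obtain a0 where a0: "F x0 = Fin a0" using noMinf by (cases "F x0") auto
  define V where "V T x = indicator_map C x + (comp_ext T G x :: 'y extended)" for T x
  define H where "H T x = F x + indicator_map C x + comp_ext T G x" for T x
  have HV: "H T x = F x + V T x" for T x by (simp add: H_def V_def add.assoc)
  have VM: "Minf \<notin> range (V T)" and HM: "Minf \<notin> range (H T)"
    and IM: "Minf \<notin> range (indicator_map C :: 'x \<Rightarrow> 'y extended)"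
    and TM: "Minf \<notin> range (comp_ext T G :: 'x \<Rightarrow> 'y extended)"
    and FIM: "Minf \<notin> range (\<lambda>x. F x + indicator_map C x)" for T
  proof -
    have range: "Minf \<notin> range Q" if "\<And>x. Q x \<noteq> Minf" for Q :: "'x \<Rightarrow> 'y extended"
      using that by (metis rangeE)
    show "Minf \<notin> range (V T)" "Minf \<notin> range (H T)" "Minf \<notin> range (indicator_map C :: 'x \<Rightarrow> 'y extended)"
      "Minf \<notin> range (comp_ext T G :: 'x \<Rightarrow> 'y extended)" "Minf \<notin> range (\<lambda>x. F x + indicator_map C x)"
      unfolding V_def H_def
      by (intro range extended_add_neq_Minf; simp add: noMinf comp_ext_eq_Minf_iff indicator_map_neq_Minf)+
  qed
  have ne: "conj_lower F L \<noteq> {}" "conj_lower (V T) L \<noteq> {}" "conj_lower (H T) L \<noteq> {}"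
    "conj_lower (indicator_map C) L \<noteq> {}" "conj_lower (comp_ext T G) L \<noteq> {}" for L T
    using conj_lower_nonempty[OF FM a0] conj_lower_nonempty[OF VM[of T], of x0 "T (- s0)"]
      conj_lower_nonempty[OF HM[of T], of x0 "a0 + T (- s0)"] conj_lower_nonempty[OF IM, of x0 0]
      conj_lower_nonempty[OF TM[of T], of x0 "T (- s0)"] x0 a0
    by (simp_all add: V_def H_def indicator_map_def comp_ext_def)
  have \<beta>1: "\<beta>1 L y \<longleftrightarrow> (\<exists>T\<in>pos_cont_lin S K. y \<notin> conj_lower (H T) L)" for L y
    unfolding \<beta>1_def Let_def H_def[symmetric] by (simp only: conj_map_avoids_iff[OF ne(3)])
  have \<beta>2: "\<beta>2 L y \<longleftrightarrow> (\<exists>L'\<in>cont_lin. \<exists>T\<in>pos_cont_lin S K.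
      y \<notin> conj_lower F L' + conj_lower (V T) (\<lambda>x. L x - L' x))" for L y
    unfolding \<beta>2_def Let_def V_def[symmetric] by (simp only: conj_map_sum_avoids_iff[OF ne(1,2)])
  have \<beta>3: "\<beta>3 L y \<longleftrightarrow> (\<exists>L'\<in>cont_lin. \<exists>L''\<in>cont_lin. \<exists>T\<in>pos_cont_lin S K.
      y \<notin> conj_lower F L' + conj_lower (indicator_map C) L''
        + conj_lower (comp_ext T G) (\<lambda>x. L x - L' x - L'' x))" for L y
    unfolding \<beta>3_def Let_def by (simp only: conj_map_sum3_avoids_iff[OF ne(1,4,5)])

  \<comment> \<open>Weak duality, for all three implications from the dual conditions to \<open>\<alpha>\<close>.\<close>
  have in_H_if_not_\<alpha>: "y \<in> conj_lower (H T) L" if fails: "\<not> \<alpha> L y" and T: "T \<in> pos_cont_lin S K" for L y T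
  proof -
    obtain x s k where x: "x \<in> C" "G x = Fin (- s)" "s \<in> S"
      and k: "F x - Fin (L x) + Fin y = Fin (- k)" "k \<in> interior K"
      using fails unfolding \<alpha>_def by blast
    obtain a where a: "F x = Fin a" using k(1) noMinf by (cases "F x") auto
    have Ts: "linear T" "T s \<in> K" using T x(3) by (auto simp: pos_cont_lin_def cont_lin_def)
    have "k + T s \<in> interior K" using cone_interior_add[OF convex_K cone_K k(2) Ts(2)] .
    moreover have "k = - (a - L x + y)" using k(1) a by simp
    ultimately have "L x - (a + T (- s)) - y \<in> interior K"
      by (simp add: linear_neg[OF Ts(1)] algebra_simps)
    moreover have "H T x = Fin (a + T (- s))" using x a by (simp add: H_def eq_Fin_iffs)
    ultimately show ?thesis unfolding mem_conj_lower[OF HM] by blast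
  qed
  have \<beta>1_imp: "\<alpha> L y" if "\<beta>1 L y" for L y
    using that in_H_if_not_\<alpha> unfolding \<beta>1 by blast
  have \<beta>2_imp: "\<alpha> L y" if b: "\<beta>2 L y" for L y
  proof (rule ccontr)
    assume "\<not> \<alpha> L y"
    obtain L' T where T: "T \<in> pos_cont_lin S K"
      and y: "y \<notin> conj_lower F L' + conj_lower (V T) (\<lambda>x. L x - L' x)"
      using b unfolding \<beta>2 by blast
    have "y \<in> conj_lower (\<lambda>x. F x + V T x) (\<lambda>x. L' x + (L x - L' x))"
      using in_H_if_not_\<alpha>[OF \<open>\<not> \<alpha> L y\<close> T] by (simp flip: HV)
    then show False using y conj_lower_add[OF FM VM] HM[of T] by (simp flip: HV)
  qed
  have \<beta>3_imp: "\<alpha> L y" if b: "\<beta>3 L y" for L y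
  proof (rule ccontr)
    assume "\<not> \<alpha> L y"
    obtain L' L'' T where T: "T \<in> pos_cont_lin S K"
      and y: "y \<notin> conj_lower F L' + conj_lower (indicator_map C) L''
        + conj_lower (comp_ext T G) (\<lambda>x. L x - L' x - L'' x)"
      using b unfolding \<beta>3 by blast
    have H: "H T = (\<lambda>x. (F x + indicator_map C x) + comp_ext T G x)" by (simp add: H_def fun_eq_iff)
    have "L = (\<lambda>x. (L' x + L'' x) + (L x - L' x - L'' x))" by (simp add: fun_eq_iff algebra_simps)
    then have "y \<in> conj_lower (\<lambda>x. (F x + indicator_map C x) + comp_ext T G x)
        (\<lambda>x. (L' x + L'' x) + (L x - L' x - L'' x))"
      using in_H_if_not_\<alpha>[OF \<open>\<not> \<alpha> L y\<close> T] unfolding H by simp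
    then have "y \<in> conj_lower (\<lambda>x. F x + indicator_map C x) (\<lambda>x. L' x + L'' x)
        + conj_lower (comp_ext T G) (\<lambda>x. L x - L' x - L'' x)"
      by (rule conj_lower_add[OF FIM TM HM[of T, unfolded H]])
    then obtain y1 y2 where y12: "y = y1 + y2"
      "y1 \<in> conj_lower (\<lambda>x. F x + indicator_map C x) (\<lambda>x. L' x + L'' x)"
      "y2 \<in> conj_lower (comp_ext T G) (\<lambda>x. L x - L' x - L'' x)" by (rule set_plus_elim)
    then have "y \<in> conj_lower F L' + conj_lower (indicator_map C) L''
        + conj_lower (comp_ext T G) (\<lambda>x. L x - L' x - L'' x)"
      using conj_lower_add[OF FM IM FIM y12(2)] by (simp add: set_plus_intro)
    then show False using y by blast
  qed

  \<comment> \<open>One pair of multipliers serves all three dual conditions.\<close>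
  have forward: "\<beta>1 L y \<and> (C2 \<longrightarrow> \<beta>2 L y) \<and> (C2 \<and> C3 \<longrightarrow> \<beta>3 L y)"
    if C1 and L: "L \<in> cont_lin" and \<alpha>: "\<alpha> L y" for L y
  proof -
    have "linear L" "continuous_on UNIV L" using L by (auto simp: cont_lin_def)
    obtain x1 a1 s1 where x1: "x1 \<in> C" "F x1 = Fin a1" "G x1 = Fin (- s1)" "s1 \<in> interior S"
    proof -
      obtain x s where "x \<in> C" "F x \<noteq> Pinf" "G x = Fin (- s)" "s \<in> interior S"
        using \<open>C1\<close> unfolding C1_def edom_def by blast
      moreover obtain a where "F x = Fin a" using \<open>F x \<noteq> Pinf\<close> noMinf by (cases "F x") auto
      ultimately show ?thesis using that by blast
    qed
    have "- (a - L x + y) \<notin> interior K"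
      if x: "x \<in> C" "F x = Fin a" "G x = Fin (- s)" "s \<in> S" for x a s
    proof
      assume k: "- (a - L x + y) \<in> interior K"
      have "F x - Fin (L x) + Fin y = Fin (- (- (a - L x + y)))" using x(2) by simp
      then have "F x - Fin (L x) + Fin y \<in> Fin ` uminus ` interior K" using k by blast
      then show False using \<alpha> x unfolding \<alpha>_def by blast
    qed
    then have "\<forall>x\<in>C. \<forall>a. \<forall>s\<in>S. F x = Fin a \<longrightarrow> G x = Fin (- s) \<longrightarrow> - (a - L x + y) \<notin> interior K"
      by blast
    note multipliers = Lagrange_multipliers[OF S \<open>cone_convex K F\<close> FM \<open>cone_convex S G\<close> GM
        \<open>convex C\<close> \<open>linear L\<close> x1 this]
    obtain f g b where f: "linear f" "continuous_on UNIV f" and g: "linear g" "continuous_on UNIV g"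
      and b: "b \<in> interior K" "f b = (1::real)"
      and fK: "\<forall>k\<in>K. 0 \<le> f k" and gS: "\<forall>s\<in>S. (0::real) \<le> g s"
      and fg: "\<And>x a q. \<lbrakk>x \<in> C; F x = Fin a; G x = Fin q\<rbrakk> \<Longrightarrow> 0 \<le> f (a - L x + y) + g q"
      using multipliers by blast
    note flin = linear_add[OF f(1)] linear_diff[OF f(1)] linear_scale[OF f(1)] linear_neg[OF f(1)]
    have f_pos: "f p > 0" if "p \<in> interior K" for p
      using cone_functional_pos_interior[OF f(1), of K b] fK b(2) that by simp
    define T where "T z = g z *\<^sub>R b" for z
    have T: "T \<in> pos_cont_lin S K"
      unfolding T_def using rank_one_pos_cont_lin[OF g gS cone_K] b(1) interior_subset by blast
    have fT: "f (T z) = g z" for z by (simp add: T_def flin b(2))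
    have "\<beta>1 L y"
    proof -
      have "y \<notin> conj_lower (H T) L"
      proof
        assume "y \<in> conj_lower (H T) L"
        then obtain x h where x: "H T x = Fin h" "L x - h - y \<in> interior K"
          unfolding mem_conj_lower[OF HM] by blast
        then obtain a q where "x \<in> C" "F x = Fin a" "G x = Fin q" "h = a + T q"
          by (auto simp: H_def eq_Fin_iffs)
        then show False using fg f_pos[OF x(2)] by (fastforce simp: flin fT)
      qed
      then show ?thesis unfolding \<beta>1 using T by blast
    qed
    have EF: "convex (scalar_epigraph F f)" and EG: "convex (scalar_epigraph G g)"
      using convex_scalar_epigraph[OF \<open>cone_convex K F\<close> FM f(1) _ zero_K]
        convex_scalar_epigraph[OF \<open>cone_convex S G\<close> GM g(1) _ zero_S] fK gS by blast+
    have fL: "linear (\<lambda>x. f (L x))" "continuous_on UNIV (\<lambda>x. f (L x))"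
      using linear_compose[OF \<open>linear L\<close> f(1)]
        continuous_on_compose2[OF f(2) \<open>continuous_on UNIV L\<close>] by (auto simp: o_def)
    have split: "\<exists>\<phi> c. linear \<phi> \<and> continuous_on UNIV \<phi>
        \<and> (\<forall>(x, r)\<in>scalar_epigraph F f. c \<le> r + \<phi> x)
        \<and> (\<forall>x\<in>C. \<forall>s. (x, s) \<in> scalar_epigraph G g \<longrightarrow> 0 \<le> s - f (L x) + f y - \<phi> x + c)" if C2
    proof -
      obtain x2 where x2: "x2 \<in> C" "G x2 \<noteq> Pinf" "continuous_at_ext F x2"
        using \<open>C2\<close> unfolding C2_def edom_def by blast
      obtain U m where U: "open U" "x2 \<in> U" "\<And>u. u \<in> U \<Longrightarrow> (u, m) \<in> scalar_epigraph F f"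
        using continuous_at_ext_scalar_bound[OF x2(3) f(2)] by blast
      obtain q2 where "G x2 = Fin q2" using x2(2) noMinf by (cases "G x2") auto
      then have mem: "(x2, g q2) \<in> scalar_epigraph G g" by (simp add: scalar_epigraph_def)
      show ?thesis
      proof (rule split_off_function[OF EF EG \<open>convex C\<close> fL(1) _ U x2(1) mem])
        fix x r s assume "(x, r) \<in> scalar_epigraph F f" "x \<in> C" "(x, s) \<in> scalar_epigraph G g"
        then obtain a q where "F x = Fin a" "f a \<le> r" "G x = Fin q" "g q \<le> s"
          by (auto simp: scalar_epigraph_def)
        then show "0 \<le> r + (s - f (L x) + f y)" using fg[OF \<open>x \<in> C\<close>, of a q] by (simp add: flin)
      qed
    qed
    have "\<beta>2 L y" if C2
    proof -
      obtain \<phi> c where \<phi>: "linear \<phi>" "continuous_on UNIV \<phi>"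
        and 1: "\<And>x r. (x, r) \<in> scalar_epigraph F f \<Longrightarrow> c \<le> r + \<phi> x"
        and 2: "\<And>x s. \<lbrakk>x \<in> C; (x, s) \<in> scalar_epigraph G g\<rbrakk> \<Longrightarrow> 0 \<le> s - f (L x) + f y - \<phi> x + c"
        using split[OF \<open>C2\<close>] by blast
      define L' where "L' x = (- \<phi> x) *\<^sub>R b" for x
      have L': "L' \<in> cont_lin"
        unfolding L'_def using \<phi> by (intro rank_one_cont_lin linear_compose_neg continuous_on_minus)
      have fL': "f (L' x) = - \<phi> x" for x by (simp add: L'_def flin b(2))
      have "y \<notin> conj_lower F L' + conj_lower (V T) (\<lambda>x. L x - L' x)"
      proof
        assume "y \<in> conj_lower F L' + conj_lower (V T) (\<lambda>x. L x - L' x)"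
        then obtain y1 y2 where y12: "y = y1 + y2"
          "y1 \<in> conj_lower F L'" "y2 \<in> conj_lower (V T) (\<lambda>x. L x - L' x)" by (rule set_plus_elim)
        obtain x a where x: "F x = Fin a" "L' x - a - y1 \<in> interior K"
          using y12(2) unfolding mem_conj_lower[OF FM] by blast
        obtain x' q where x': "x' \<in> C" "G x' = Fin q" "L x' - L' x' - T q - y2 \<in> interior K"
          using y12(3) unfolding mem_conj_lower[OF VM] by (auto simp: V_def eq_Fin_iffs)
        show False
          using f_pos[OF x(2)] f_pos[OF x'(3)] 1[of x "f a"] 2[OF x'(1), of "g q"] x(1) x'(2) y12(1)
          by (simp add: flin fT fL' scalar_epigraph_def)
      qed
      then show ?thesis unfolding \<beta>2 using T L' by blast
    qed
    moreover have "\<beta>3 L y" if C2 C3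
    proof -
      obtain \<phi> c where \<phi>: "linear \<phi>" "continuous_on UNIV \<phi>"
        and 1: "\<And>x r. (x, r) \<in> scalar_epigraph F f \<Longrightarrow> c \<le> r + \<phi> x"
        and 2: "\<And>x s. \<lbrakk>x \<in> C; (x, s) \<in> scalar_epigraph G g\<rbrakk> \<Longrightarrow> 0 \<le> s - f (L x) + f y - \<phi> x + c"
        using split[OF \<open>C2\<close>] by blast
      obtain x3 where x3: "x3 \<in> C" "continuous_at_ext G x3" using \<open>C3\<close> unfolding C3_def by blast
      obtain U m where U: "open U" "x3 \<in> U" "\<And>u. u \<in> U \<Longrightarrow> (u, m) \<in> scalar_epigraph G g"
        using continuous_at_ext_scalar_bound[OF x3(2) g(2)] by blast
      define l where "l x = f (L x) + \<phi> x" for x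
      have l: "linear l" "continuous_on UNIV l"
        unfolding l_def using fL \<phi> by (auto intro: linear_compose_add continuous_on_add)
      have "0 \<le> s - l x + (f y + c)" if "x \<in> C" "(x, s) \<in> scalar_epigraph G g" for x s
        using 2[OF that] by (simp add: l_def)
      then obtain \<psi> d where \<psi>: "linear \<psi>" "continuous_on UNIV \<psi>"
        and 3: "\<And>x s. (x, s) \<in> scalar_epigraph G g \<Longrightarrow> d \<le> s - l x + (f y + c) + \<psi> x"
        and 4: "\<And>x. x \<in> C \<Longrightarrow> \<psi> x \<le> d"
        using split_off_constraint[OF EG \<open>convex C\<close> l _ U x3(1)] by blast
      define L' where "L' x = (- \<phi> x) *\<^sub>R b" for x
      define L'' where "L'' x = \<psi> x *\<^sub>R b" for x
      have L': "L' \<in> cont_lin" "L'' \<in> cont_lin"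
        using rank_one_cont_lin[OF linear_compose_neg[OF \<phi>(1)] continuous_on_minus[OF \<phi>(2)], of b]
          rank_one_cont_lin[OF \<psi>, of b]
        unfolding L'_def L''_def by auto
      have fL': "f (L' x) = - \<phi> x" "f (L'' x) = \<psi> x" for x by (simp_all add: L'_def L''_def flin b(2))
      have "y \<notin> conj_lower F L' + conj_lower (indicator_map C) L''
        + conj_lower (comp_ext T G) (\<lambda>x. L x - L' x - L'' x)"
      proof
        assume "y \<in> conj_lower F L' + conj_lower (indicator_map C) L''
          + conj_lower (comp_ext T G) (\<lambda>x. L x - L' x - L'' x)"
        then obtain y1 y2 y3 where y123: "y = y1 + y2 + y3"
          "y1 \<in> conj_lower F L'" "y2 \<in> conj_lower (indicator_map C) L''"
          "y3 \<in> conj_lower (comp_ext T G) (\<lambda>x. L x - L' x - L'' x)" by (blast elim: set_plus_elim)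
        obtain x a where x: "F x = Fin a" "L' x - a - y1 \<in> interior K"
          using y123(2) unfolding mem_conj_lower[OF FM] by blast
        obtain x' where x': "x' \<in> C" "L'' x' - 0 - y2 \<in> interior K"
          using y123(3) unfolding mem_conj_lower[OF IM] by (auto simp: eq_Fin_iffs)
        obtain x'' q where x'': "G x'' = Fin q" "L x'' - L' x'' - L'' x'' - T q - y3 \<in> interior K"
          using y123(4) unfolding mem_conj_lower[OF TM] by (auto simp: eq_Fin_iffs)
        have "c \<le> f a + \<phi> x" "d \<le> g q - l x'' + (f y + c) + \<psi> x''"
          using 1[of x "f a"] 3[of x'' "g q"] x(1) x''(1) by (simp_all add: scalar_epigraph_def)
        then show False
          using f_pos[OF x(2)] f_pos[OF x'(2)] f_pos[OF x''(2)] 4[OF x'(1)] y123(1)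
          by (simp add: flin fT fL' l_def)
      qed
      then show ?thesis unfolding \<beta>3 using T L' by blast
    qed
    ultimately show ?thesis using \<open>\<beta>1 L y\<close> by blast
  qed
  show ?thesis using forward \<beta>1_imp \<beta>2_imp \<beta>3_imp by blast
qed

end
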